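(* Let $\Omega$ be a $D$-set, possibly augmented with unary predicates. Let $s=(s^1,\ldots,s^n)$ be an unbounded indiscernible sequence of $n$-tuples indexed by $I$, and let $B\subseteq\Omega$. Then $s$ is weakly indiscernible over $B$ if and only if $B\cap H(s)=\emptyset$.
   Context: A $D$-set is a set $\Omega$ with a quaternary relation $D$, written $D(wx;yz)$ or $wx|yz$, satisfying for all $w,x,y,z$: (D1) $D(wx;yz)\to (D(xw;yz)\wedge D(yz;wx))$; (D2) $D(wx;yz)\to\neg D(wy;xz)$; (D3) $D(wx;yz)\to\forall v\,(D(vx;yz)\vee D(wx;yv))$; (D4) $(w\neq y\wedge x\neq y)\to D(wx;yy)$. A splitting of $\Omega$ is a partition into at least two parts (sectors) such that (i) if $a,b$ lie in a part $\Sigma$ and $c,d\notin\Sigma$ then $D(ab;cd)$, (ii) if $a,b,c,d$ lie in four distinct parts then $\neg D(ab;cd)$; a node splitting has more than two sectors. Every splitting of a subset $A$ with more than two parts extends uniquely to a node splitting of $\Omega$ whose sectors meet $A$ in the parts. Sequences are indexed by a linear order $I$; unbounded means $I$ has no least or greatest element; indiscernible means order-indiscernible over $\emptyset$; an $n$-element sequence $s$ has component sequences $s^1,\dots,s^n$ (the $k$-th coordinates), each an indiscernible sequence of single elements. An indiscernible sequence $t=(a_i)$ of single elements is constant, or petaled (pairwise distinct and no $D(a_ia_j;a_ka_\ell)$ with $i,j,k,\ell$ pairwise distinct), or monotonic (pairwise distinct and $a_ia_j|a_ka_\ell$ for $i<j<k<\ell$). Its discernible hull $H(t)$ is: $\emptyset$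 if constant; if petaled, the union of the sectors containing elements of $t$ of the node splitting of $\Omega$ extending $\{\{a_i\}:i\in I\}$; if monotonic, $t\cup H_1(t)\cup H_2(t)\cup H_3(t)$ with $H_1(t)=\{x:\exists i<j<k,\ a_ia_k|a_jx\}$, $H_2(t)=\{x:\exists i<j<k$ with no $D$-relation among distinct elements of $\{a_i,a_j,a_k,x\}\}$, $H_3(t)=\{x:\exists i<j<k<\ell,\ a_ix|a_ka_\ell\wedge a_ia_j|xa_\ell\}$. For $n$-element $s$, $H(s)=\bigcup_k H(s^k)$. $s$ is weakly indiscernible over $B$ if for every atomic formula $D(t_1t_2;t_3t_4)$ whose terms are variables or parameters from $B$, its truth value when variables are replaced by coordinates of terms of $s$ depends only on the order type of the indices used. *)

theory Defs
  imports Main "HOL-Library.Disjoint_Sets"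
begin

text \<open>The underlying set \<open>\<Omega>\<close> of a D-set is the universe of the type \<open>'a\<close>;
  \<open>D w x y z\<close> stands for \<open>D(wx;yz)\<close>.\<close>

locale D_set =
  fixes D :: "'a \<Rightarrow> 'a \<Rightarrow> 'a \<Rightarrow> 'a \<Rightarrow> bool"
  assumes D1: "D w x y z \<Longrightarrow> D x w y z \<and> D y z w x"
    and D2: "D w x y z \<Longrightarrow> \<not> D w y x z"
    and D3: "D w x y z \<Longrightarrow> \<forall>v. D v x y z \<or> D w x y v"
    and D4: "w \<noteq> y \<and> x \<noteq> y \<Longrightarrow> D w x y y"

definition splitting :: "('a \<Rightarrow> 'a \<Rightarrow> 'a \<Rightarrow> 'a \<Rightarrow> bool) \<Rightarrow> 'a set \<Rightarrow> 'a set set \<Rightarrow> bool" where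
  "splitting D A P \<longleftrightarrow>
     partition_on A P \<and>
     (\<exists>S\<in>P. \<exists>T\<in>P. S \<noteq> T) \<and>
     (\<forall>S\<in>P. \<forall>a\<in>S. \<forall>b\<in>S. \<forall>c\<in>A - S. \<forall>d\<in>A - S. D a b c d) \<and>
     (\<forall>S\<^sub>1\<in>P. \<forall>S\<^sub>2\<in>P. \<forall>S\<^sub>3\<in>P. \<forall>S\<^sub>4\<in>P. distinct [S\<^sub>1, S\<^sub>2, S\<^sub>3, S\<^sub>4] \<longrightarrow>
        (\<forall>a\<in>S\<^sub>1. \<forall>b\<in>S\<^sub>2. \<forall>c\<in>S\<^sub>3. \<forall>d\<in>S\<^sub>4. \<not> D a b c d))"

definition node_splitting :: "('a \<Rightarrow> 'a \<Rightarrow> 'a \<Rightarrow> 'a \<Rightarrow> bool) \<Rightarrow> 'a set \<Rightarrow> 'a set set \<Rightarrow> bool" where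
  "node_splitting D A P \<longleftrightarrow>
     splitting D A P \<and> (\<exists>S\<in>P. \<exists>T\<in>P. \<exists>R\<in>P. distinct [S, T, R])"

text \<open>The extension of a splitting \<open>P\<close> of \<open>A\<close> to \<open>\<Omega>\<close>. It may have sectors that do not
  meet \<open>A\<close>, hence the removal of the empty trace.\<close>

definition node_extension :: "('a \<Rightarrow> 'a \<Rightarrow> 'a \<Rightarrow> 'a \<Rightarrow> bool) \<Rightarrow> 'a set \<Rightarrow> 'a set set \<Rightarrow> 'a set set" where
  "node_extension D A P = (THE Q. node_splitting D UNIV Q \<and> (\<lambda>S. S \<inter> A) ` Q - {{}} = P)"

definition constant_seq :: "('i \<Rightarrow> 'a) \<Rightarrow> bool" where
  "constant_seq t \<longleftrightarrow> (\<forall>i j. t i = t j)"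

definition petaled :: "('a \<Rightarrow> 'a \<Rightarrow> 'a \<Rightarrow> 'a \<Rightarrow> bool) \<Rightarrow> ('i \<Rightarrow> 'a) \<Rightarrow> bool" where
  "petaled D t \<longleftrightarrow> inj t \<and> (\<forall>i j k l. distinct [i, j, k, l] \<longrightarrow> \<not> D (t i) (t j) (t k) (t l))"

definition monotonic :: "('a \<Rightarrow> 'a \<Rightarrow> 'a \<Rightarrow> 'a \<Rightarrow> bool) \<Rightarrow> ('i::linorder \<Rightarrow> 'a) \<Rightarrow> bool" where
  "monotonic D t \<longleftrightarrow>
     inj t \<and> (\<forall>i j k l. i < j \<and> j < k \<and> k < l \<longrightarrow> D (t i) (t j) (t k) (t l))"

definition petal_hull :: "('a \<Rightarrow> 'a \<Rightarrow> 'a \<Rightarrow> 'a \<Rightarrow> bool) \<Rightarrow> ('i \<Rightarrow> 'a) \<Rightarrow> 'a set" where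
  "petal_hull D t =
     \<Union>{S \<in> node_extension D (range t) {{t i} |i. True}. S \<inter> range t \<noteq> {}}"

definition H1 :: "('a \<Rightarrow> 'a \<Rightarrow> 'a \<Rightarrow> 'a \<Rightarrow> bool) \<Rightarrow> ('i::linorder \<Rightarrow> 'a) \<Rightarrow> 'a set" where
  "H1 D t = {x. \<exists>i j k. i < j \<and> j < k \<and> D (t i) (t k) (t j) x}"

definition H2 :: "('a \<Rightarrow> 'a \<Rightarrow> 'a \<Rightarrow> 'a \<Rightarrow> bool) \<Rightarrow> ('i::linorder \<Rightarrow> 'a) \<Rightarrow> 'a set" where
  "H2 D t = {x. \<exists>i j k. i < j \<and> j < k \<and>
     (let F = {t i, t j, t k, x} in
       \<forall>p\<in>F. \<forall>q\<in>F. \<forall>r\<in>F. \<forall>u\<in>F. distinct [p, q, r, u] \<longrightarrow> \<not> D p q r u)}"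

definition H3 :: "('a \<Rightarrow> 'a \<Rightarrow> 'a \<Rightarrow> 'a \<Rightarrow> bool) \<Rightarrow> ('i::linorder \<Rightarrow> 'a) \<Rightarrow> 'a set" where
  "H3 D t = {x. \<exists>i j k l. i < j \<and> j < k \<and> k < l \<and>
     D (t i) x (t k) (t l) \<and> D (t i) (t j) x (t l)}"

text \<open>The last branch is never reached for an indiscernible sequence without end points.\<close>

definition hull1 :: "('a \<Rightarrow> 'a \<Rightarrow> 'a \<Rightarrow> 'a \<Rightarrow> bool) \<Rightarrow> ('i::linorder \<Rightarrow> 'a) \<Rightarrow> 'a set" where
  "hull1 D t =
     (if constant_seq t then {}
      else if petaled D t then petal_hull D t
      else if monotonic D t then range t \<union> H1 D t \<union> H2 D t \<union> H3 D t
      else {})"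

text \<open>A sequence of \<open>n\<close>-tuples is given by its component sequences \<open>s 1, \<dots>, s n\<close>, so
  \<open>s k i\<close> is the \<open>k\<close>-th coordinate of the \<open>i\<close>-th term; other values of \<open>k\<close> play no role.\<close>

definition hull :: "('a \<Rightarrow> 'a \<Rightarrow> 'a \<Rightarrow> 'a \<Rightarrow> bool) \<Rightarrow> nat \<Rightarrow> (nat \<Rightarrow> 'i::linorder \<Rightarrow> 'a) \<Rightarrow> 'a set" where
  "hull D n s = (\<Union>k\<in>{1..n}. hull1 D (s k))"

text \<open>First-order formulas in the language with equality, the relation symbol for \<open>D\<close> and
  unary predicate symbols from \<open>'p\<close>, with named variables from \<open>'v\<close>.\<close>

datatype (preds: 'p, 'v) fm =
    Eq 'v 'v
  | Rel 'v 'v 'v 'v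
  | Pred 'p 'v
  | Neg "('p, 'v) fm"
  | Conj "('p, 'v) fm" "('p, 'v) fm"
  | Ex 'v "('p, 'v) fm"

primrec fv :: "('p, 'v) fm \<Rightarrow> 'v set" where
  "fv (Eq x y) = {x, y}"
| "fv (Rel w x y z) = {w, x, y, z}"
| "fv (Pred p x) = {x}"
| "fv (Neg \<phi>) = fv \<phi>"
| "fv (Conj \<phi> \<psi>) = fv \<phi> \<union> fv \<psi>"
| "fv (Ex x \<phi>) = fv \<phi> - {x}"

primrec sat ::
  "('a \<Rightarrow> 'a \<Rightarrow> 'a \<Rightarrow> 'a \<Rightarrow> bool) \<Rightarrow> ('p \<Rightarrow> 'a \<Rightarrow> bool) \<Rightarrow> ('v \<Rightarrow> 'a) \<Rightarrow> ('p, 'v) fm \<Rightarrow> bool" where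
  "sat D U e (Eq x y) \<longleftrightarrow> e x = e y"
| "sat D U e (Rel w x y z) \<longleftrightarrow> D (e w) (e x) (e y) (e z)"
| "sat D U e (Pred p x) \<longleftrightarrow> U p (e x)"
| "sat D U e (Neg \<phi>) \<longleftrightarrow> \<not> sat D U e \<phi>"
| "sat D U e (Conj \<phi> \<psi>) \<longleftrightarrow> sat D U e \<phi> \<and> sat D U e \<psi>"
| "sat D U e (Ex x \<phi>) \<longleftrightarrow> (\<exists>a. sat D U (e(x := a)) \<phi>)"

text \<open>Order-indiscernibility over the empty set in the language whose unary predicate symbols
  are those in \<open>L\<close> (\<open>L = {}\<close> is the pure language of D-sets). The variable \<open>(r, k)\<close> stands
  for the \<open>k\<close>-th coordinate of the \<open>r\<close>-th tuple argument of the formula.\<close>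

definition indiscernible ::
  "('a \<Rightarrow> 'a \<Rightarrow> 'a \<Rightarrow> 'a \<Rightarrow> bool) \<Rightarrow> 'p set \<Rightarrow> ('p \<Rightarrow> 'a \<Rightarrow> bool) \<Rightarrow> nat \<Rightarrow>
   (nat \<Rightarrow> 'i::linorder \<Rightarrow> 'a) \<Rightarrow> bool" where
  "indiscernible D L U n s \<longleftrightarrow>
     (\<forall>m. \<forall>\<phi> :: ('p, nat \<times> nat) fm. \<forall>\<iota> \<iota>' :: nat \<Rightarrow> 'i.
        preds \<phi> \<subseteq> L \<and> fv \<phi> \<subseteq> {1..m} \<times> {1..n} \<and>
        strict_mono_on {1..m} \<iota> \<and> strict_mono_on {1..m} \<iota>' \<longrightarrow>
        (sat D U (\<lambda>(r, k). s k (\<iota> r)) \<phi> \<longleftrightarrow> sat D U (\<lambda>(r, k). s k (\<iota>' r)) \<phi>))"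

datatype (vars: 'v, params: 'a) trm = Var 'v | Param 'a

primrec val :: "('v \<Rightarrow> 'a) \<Rightarrow> ('v, 'a) trm \<Rightarrow> 'a" where
  "val e (Var v) = e v"
| "val e (Param b) = b"

text \<open>The variable \<open>v\<close> is replaced by the coordinate \<open>\<kappa> v\<close> of the term of \<open>s\<close> with
  index \<open>\<iota> v\<close>; for a fixed choice \<open>\<kappa>\<close> of coordinates the truth value may depend on \<open>\<iota>\<close> only
  through the order type of the indices.\<close>

definition weakly_indiscernible ::
  "('a \<Rightarrow> 'a \<Rightarrow> 'a \<Rightarrow> 'a \<Rightarrow> bool) \<Rightarrow> nat \<Rightarrow> (nat \<Rightarrow> 'i::linorder \<Rightarrow> 'a) \<Rightarrow> 'a set \<Rightarrow> bool" where
  "weakly_indiscernible D n s B \<longleftrightarrow>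
     (\<forall>t\<^sub>1 t\<^sub>2 t\<^sub>3 t\<^sub>4 :: (nat, 'a) trm.
        let V = vars t\<^sub>1 \<union> vars t\<^sub>2 \<union> vars t\<^sub>3 \<union> vars t\<^sub>4;
            holds = (\<lambda>e. D (val e t\<^sub>1) (val e t\<^sub>2) (val e t\<^sub>3) (val e t\<^sub>4))
        in params t\<^sub>1 \<union> params t\<^sub>2 \<union> params t\<^sub>3 \<union> params t\<^sub>4 \<subseteq> B \<longrightarrow>
           (\<forall>\<kappa> :: nat \<Rightarrow> nat. \<forall>\<iota> \<iota>' :: nat \<Rightarrow> 'i.
              \<kappa> ` V \<subseteq> {1..n} \<and> (\<forall>u\<in>V. \<forall>v\<in>V. \<iota> u < \<iota> v \<longleftrightarrow> \<iota>' u < \<iota>' v) \<longrightarrow>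
              (holds (\<lambda>v. s (\<kappa> v) (\<iota> v)) \<longleftrightarrow> holds (\<lambda>v. s (\<kappa> v) (\<iota>' v)))))"

end

theory Submission imports Defs begin

text \<open>
  View the D-set as the leaves of a tree. A monotonic sequence hangs off a line, a petaled one off a
  node, and the hull consists of the leaves hanging off that line, respectively lying in the petals
  of that node. A parameter in the hull sits at a definite place among the terms and so tells
  them apart.

  A parameter outside the hull lies beyond one of the two ends of the line, respectively in an
  unused sector of the node; by indiscernibility the same holds for a term of another component
  relative to the part of the sequence on either side of its index. Hence the truth of an atomic
  formula does not change when a single index moves without passing another one. When several
  variables share an index, (D3) either reduces the formula to single moves or replaces the
  parameters by far away terms of the sequence, where indiscernibility applies.
\<close>

text \<open>The obstacle is ties. Variables sharing an index must move together, so single moves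
  cannot reach them. A formula without parameters is covered by indiscernibility; otherwise a
  parameter, brought to the last place by the symmetries of \<open>D\<close>, leaves at most three
  indices, and the tie patterns are a pair on one side of \<open>D\<close>, a pair on opposite
  sides, and a triple. A tied pair at i is compared with the pair spread over two indices: single
  moves fix the truth value of each spread version, and these values either decide the tied formula
  or show that terms at outer indices a and d can stand in for the other two arguments. Both
  directions read the hull through \<open>D\<close> alone. For a petaled t this means describing the
  petal hull as the set of x with \<open>D x (t i) (t j) (t k)\<close> for some i and some distinct
  j, k; as \<open>node_extension\<close> is a definite description, the node splitting has to be
  constructed and shown to be unique. Unboundedness supplies the spare indices below and
  above.\<close>

definition ord_eq :: "'i::linorder list \<Rightarrow> 'i list \<Rightarrow> bool" where
  "ord_eq is js \<longleftrightarrow>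
     (\<forall>p\<in>set (zip is js). \<forall>q\<in>set (zip is js). fst p < fst q \<longleftrightarrow> snd p < snd q)"

section \<open>Elementary consequences of the D-set axioms\<close>

context D_set
begin

lemma D_swap_left: "D a b c d \<longleftrightarrow> D b a c d"
  using D1 by blast

lemma D_swap_sides: "D a b c d \<longleftrightarrow> D c d a b"
  using D1 by blast

lemma D_swap_right: "D a b c d \<longleftrightarrow> D a b d c"
  using D1 by blast

lemma D_excl_mid: "D a b c d \<Longrightarrow> D a c b d \<Longrightarrow> False"
  using D2 by blast

lemma D_excl_last: "D a b c d \<Longrightarrow> D a d b c \<Longrightarrow> False"
  using D2 D_swap_right by blast

text \<open>By (D2), wx|wz excludes ww|xz. Yet (D4) yields ww|xz when w differs from x and z; in the
  remaining cases the relation, up to swapping sides, excludes itself.\<close>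

lemma D_disjoint: 
  assumes "D a b c d"
  shows "a \<noteq> c" "a \<noteq> d" "b \<noteq> c" "b \<noteq> d"
proof -
  have *: "w \<noteq> y" if "D w x y z" for w x y z
    using that D2 D4 D1 by metis
  show "a \<noteq> c" "a \<noteq> d" "b \<noteq> c" "b \<noteq> d"
    using * assms D_swap_left D_swap_right by blast+
qed

lemma D_refl: "D a a c d \<longleftrightarrow> a \<noteq> c \<and> a \<noteq> d"
  using D_disjoint D4 D_swap_sides by metis

lemma D_refl_right: "D c d a a \<longleftrightarrow> a \<noteq> c \<and> a \<noteq> d"
  using D_refl D_swap_sides by blast

lemma D_subst13: "D a b c d \<Longrightarrow> D v b c d \<or> D a b v d"
  and D_subst14: "D a b c d \<Longrightarrow> D v b c d \<or> D a b c v"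
  and D_subst23: "D a b c d \<Longrightarrow> D a v c d \<or> D a b v d"
  and D_subst24: "D a b c d \<Longrightarrow> D a v c d \<or> D a b c v"
  using D3 D_swap_left D_swap_right by blast+

lemma D_incompatible:
  assumes "D a b c d"
  shows "\<not> D a c b d" "\<not> D c a b d" "\<not> D a c d b" "\<not> D c a d b"
    "\<not> D b d a c" "\<not> D d b a c" "\<not> D b d c a" "\<not> D d b c a"
    "\<not> D a d b c" "\<not> D d a b c" "\<not> D a d c b" "\<not> D d a c b"
    "\<not> D b c a d" "\<not> D c b a d" "\<not> D b c d a" "\<not> D c b d a"
  using assms D_excl_mid D_excl_last D_swap_left D_swap_right D_swap_sides by blast+

text \<open>If ac|zw fails, (D3) turns the hypotheses into ab|cw and bc|aw, two different pairings
  of the same four elements.\<close>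

lemma D_trans: 
  assumes "D a b z w" "D b c z w" 
  shows "D a c z w"
  using D_subst23[OF assms(1), of c] D_subst13[OF assms(2), of a] D_incompatible
  by blast

lemma D_trans_right: "D z w a b \<Longrightarrow> D z w b c \<Longrightarrow> D z w a c"
  using D_trans D_swap_sides by blast

text \<open>For fixed \<open>z, w\<close> the relation \<open>D u z v w\<close> is a strict weak order in \<open>u, v\<close>.\<close>

lemma between_asym: "D u z v w \<Longrightarrow> \<not> D v z u w"
  by (rule D_incompatible)

lemma between_neg_trans: "D u z x w \<Longrightarrow> D u z v w \<or> D v z x w"
  using D_subst13 by blast

text \<open>In the tree, \<open>D u z v w\<close> says that u leaves the path from z to w before v
  does. As p leaves before and q after both a and b, they can stand in for the ends z and w. This
  later replaces arbitrary arguments by terms of a sequence.\<close>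

lemma caterpillar:
  assumes pa: "D p z a w" and pb: "D p z b w" and aq: "D a z q w" and bq: "D b z q w"
  shows "D a z b w \<longleftrightarrow> D p a b q"
proof
  assume ab: "D a z b w"
  have "D a p b w"
    using D_subst23[OF ab, of p] between_asym[OF pa] by blast
  moreover have "D b a q w"
    using D_subst23[OF bq, of a] between_asym[OF ab] by blast
  ultimately show "D p a b q"
    using D_subst24[of a p b w q] D_incompatible(14)[of b a q w] D_swap_left by blast
next
  assume *: "D p a b q"
  have "D p z a q"
    using D_subst14[OF pa, of q] between_asym[OF aq] by blast
  then have "D z a b q"
    using D_subst13[OF *, of z] D_incompatible by blast
  moreover have "\<not> D z w b q"
    using D_incompatible[OF bq] by blast
  ultimately show "D a z b w"
    using D_subst24[of z a b q w] D_swap_left by blast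
qed

end

section \<open>The node of a petaled sequence\<close>

definition same_petal :: "('a \<Rightarrow> 'a \<Rightarrow> 'a \<Rightarrow> 'a \<Rightarrow> bool) \<Rightarrow> ('i \<Rightarrow> 'a) \<Rightarrow> 'a \<Rightarrow> 'a \<Rightarrow> bool" where
  "same_petal D t x y \<longleftrightarrow> (\<exists>i j. i \<noteq> j \<and> D x y (t i) (t j))"

locale petaled_seq = D_set D for D :: "'a \<Rightarrow> 'a \<Rightarrow> 'a \<Rightarrow> 'a \<Rightarrow> bool" +
  fixes t :: "'i \<Rightarrow> 'a"
  assumes petaled: "petaled D t" and infinite_index: "infinite (UNIV :: 'i set)"
begin

abbreviation same :: "'a \<Rightarrow> 'a \<Rightarrow> bool" (infix "\<approx>" 50) where
  "x \<approx> y \<equiv> same_petal D t x y"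

lemma sameI: "D x y (t i) (t j) \<Longrightarrow> i \<noteq> j \<Longrightarrow> x \<approx> y"
  unfolding same_petal_def by (intro exI conjI)

lemma sameE:
  assumes "x \<approx> y"
  obtains i j where "i \<noteq> j" "D x y (t i) (t j)"
  using assms unfolding same_petal_def by (elim exE conjE)

lemma t_eq_iff: "t i = t j \<longleftrightarrow> i = j"
  using petaled by (auto simp: petaled_def inj_def)

lemma no_D_terms: "i \<noteq> j \<Longrightarrow> k \<noteq> l \<Longrightarrow> \<not> D (t i) (t j) (t k) (t l)"
  using petaled D_disjoint[of "t i" "t j" "t k" "t l"] unfolding petaled_def
  by (metis distinct_length_2_or_more distinct_singleton)

lemma fresh_index: "finite A \<Longrightarrow> \<exists>i. i \<notin> (A :: 'i set)"
  using ex_new_if_finite infinite_index by blast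

text \<open>The two indices in \<open>same_petal\<close> are distinct because (D4) gives xy|aa for
  any x, y other than a. The exceptional m is the petal that may contain x and y: if two terms
  failed against t_i, (D3) would place both beside y, producing a relation among four terms.
  Cofinality gives any two related pairs a common pair of witnesses.\<close>

lemma same_cofinal:
  assumes "x \<approx> y"
  shows "\<exists>m. \<forall>k l. k \<noteq> m \<longrightarrow> l \<noteq> m \<longrightarrow> D x y (t k) (t l)"
proof -
  obtain i j where ij: "i \<noteq> j" "D x y (t i) (t j)"
    using sameE[OF assms] by blast
  have ii: "D x y (t i) (t i)"
    using D_disjoint[OF ij(2)] D_refl_right by metis
  have "\<exists>m. \<forall>k. k \<noteq> m \<longrightarrow> D x y (t i) (t k)"
  proof (cases "\<exists>m. \<not> D x y (t i) (t m)")
    case True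
    then obtain m where m: "\<not> D x y (t i) (t m)" by blast
    have "D x y (t i) (t k)" if "k \<noteq> m" for k
    proof (rule ccontr)
      assume k: "\<not> D x y (t i) (t k)"
      have "D (t m) y (t i) (t j)" "D (t k) y (t i) (t j)"
        using D_subst14[OF ij(2)] m k by blast+
      then have "D (t m) (t k) (t i) (t j)"
        using D_trans D_swap_left by blast
      then show False using no_D_terms[of m k i j] ij(1) that by simp
    qed
    then show ?thesis by blast
  qed blast
  then obtain m where "\<And>k. k \<noteq> m \<Longrightarrow> D x y (t i) (t k)" by blast
  then have "D x y (t k) (t l)" if "k \<noteq> m" "l \<noteq> m" for k l
    using D_trans_right[of x y "t k" "t i" "t l"] D_swap_right[of x y "t k" "t i"] that by simp
  then show ?thesis by blast
qed

lemma same_sym: "x \<approx> y \<Longrightarrow> y \<approx> x"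
  unfolding same_petal_def using D_swap_left by blast

lemma finite_hits: "finite {i. t i = x}"
proof (cases "\<exists>i. t i = x")
  case True
  then obtain i where "t i = x" by blast
  then have "{i. t i = x} = {i}" using t_eq_iff by auto
  then show ?thesis by simp
qed simp

lemma same_refl: "x \<approx> x"
proof -
  obtain i where i: "t i \<noteq> x" using fresh_index[OF finite_hits[of x]] by blast
  obtain j where j: "t j \<noteq> x" "j \<noteq> i" 
    using fresh_index[of "insert i {j. t j = x}"] finite_hits[of x] by auto
  then show ?thesis unfolding same_petal_def using i D_refl by metis
qed

lemma same_trans: assumes "x \<approx> y" "y \<approx> z" shows "x \<approx> z"
proof -
  obtain m where m: "\<And>k l. k \<noteq> m \<Longrightarrow> l \<noteq> m \<Longrightarrow> D x y (t k) (t l)"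
    using same_cofinal assms(1) by blast
  obtain m' where m': "\<And>k l. k \<noteq> m' \<Longrightarrow> l \<noteq> m' \<Longrightarrow> D y z (t k) (t l)"
    using same_cofinal assms(2) by blast
  obtain i where i: "i \<notin> {m, m'}" using fresh_index[of "{m, m'}"] by blast
  obtain j where j: "j \<notin> {m, m', i}" using fresh_index[of "{m, m', i}"] by blast
  have "D x z (t i) (t j)" using D_trans m[of i j] m'[of i j] i j by blast
  then show ?thesis using sameI[of x z i j] j by auto
qed

lemma same_terms: "t i \<approx> t j \<longleftrightarrow> i = j"
  by (metis same_refl no_D_terms sameE)

lemma finite_same_terms: "finite {i. t i \<approx> x}"
proof (cases "\<exists>i. t i \<approx> x")
  case True
  then obtain i where i: "t i \<approx> x" by blast
  then have "j = i" if "t j \<approx> x" for j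
    using same_terms[of j i] same_trans[OF that same_sym[OF i]] by simp
  then have "{j. t j \<approx> x} \<subseteq> {i}" by blast
  then show ?thesis using finite_subset by blast
qed simp

text \<open>Condition (i) of a splitting. Replacing a witness term by x in ab|t_i t_j can fail only
  through ax|t_i t_j, which puts x into the petal of a.\<close>

lemma same_D_not_same:
  assumes ab: "a \<approx> b" and c: "\<not> a \<approx> c" and d: "\<not> a \<approx> d"
  shows "D a b c d"
proof -
  obtain m where m: "\<And>k l. k \<noteq> m \<Longrightarrow> l \<noteq> m \<Longrightarrow> D a b (t k) (t l)"
    using same_cofinal ab by blast
  obtain i where i: "i \<noteq> m" using fresh_index[of "{m}"] by blast
  obtain j where j: "j \<noteq> m" "j \<noteq> i" using fresh_index[of "{m, i}"] by blast
  have "D a b (t i) x" if "\<not> a \<approx> x" for x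
  proof -
    have "\<not> D a x (t i) (t j)"
      using that j(2) sameI by metis
    then show ?thesis using D_subst24[OF m[OF i j(1)], of x] by blast
  qed
  from this[OF c] this[OF d] show ?thesis
    using D_trans_right[of a b c "t i" d] D_swap_right[of a b c "t i"] by simp
qed

text \<open>This implies condition (ii) of a splitting. With fresh petals i, j, k, (D3) exchanges
  one outer argument for t_i and the opposite one for t_j, since refusing the second exchange would
  identify a with b or c with d. A last exchange against t_k identifies an argument with a fresh
  petal.\<close>

lemma not_same_not_D:
  assumes ab: "\<not> a \<approx> b" and cd: "\<not> c \<approx> d"
  shows "\<not> D a b c d"
proof
  assume D: "D a b c d"
  have fin: "finite ({i. t i \<approx> a} \<union> {i. t i \<approx> b} \<union> {i. t i \<approx> c} \<union> {i. t i \<approx> d})" (is "finite ?F")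
    using finite_same_terms by simp
  obtain i where i: "i \<notin> ?F" using fresh_index[OF fin] by blast
  obtain j where j: "j \<notin> ?F" "j \<noteq> i" using fresh_index[of "insert i ?F"] fin by auto
  obtain k where k: "k \<notin> ?F" "k \<noteq> i" "k \<noteq> j" using fresh_index[of "insert i (insert j ?F)"] fin by auto
  have no: "\<not> D (t p) x y (t q)"
    if "p \<noteq> q" "p \<noteq> k" "q \<noteq> k" "\<not> t p \<approx> x" "\<not> t q \<approx> y" for p q x y
  proof
    assume "D (t p) x y (t q)"
    then have "D (t p) (t k) y (t q) \<or> D (t p) x (t k) (t q)"
      using D_subst23 by blast
    moreover have "\<not> D (t p) (t k) y (t q)"
      using that(2,5) D_swap_sides D_swap_left sameI by metis
    moreover have "\<not> D (t p) x (t k) (t q)"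
      using that(3,4) sameI by metis
    ultimately show False by blast
  qed
  from D_subst14[OF D, of "t i"] show False
  proof
    assume 1: "D (t i) b c d"
    have "\<not> D (t i) (t j) c d"
      using j(2) cd D_swap_sides sameI by metis
    then have "D (t i) b c (t j)" using D_subst24[OF 1, of "t j"] by blast
    then show False using no[of i j b c] i j k by blast
  next
    assume 1: "D a b c (t i)"
    have "\<not> D a b (t j) (t i)"
      using j(2) ab sameI by metis
    then have "D (t j) b c (t i)" using D_subst13[OF 1, of "t j"] by blast
    then show False using no[of j i b c] i j k by blast
  qed
qed

definition petals :: "'a set set" where
  "petals = range (\<lambda>x. {y. x \<approx> y})"

lemma petalD: "S \<in> petals \<Longrightarrow> x \<in> S \<Longrightarrow> S = {y. x \<approx> y}"
  unfolding petals_def using same_sym same_trans by blast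

lemma petal_eqI: "S \<in> petals \<Longrightarrow> T \<in> petals \<Longrightarrow> x \<in> S \<Longrightarrow> y \<in> T \<Longrightarrow> x \<approx> y \<Longrightarrow> S = T"
  using petalD[of S x] petalD[of T y] same_sym same_trans by blast

lemma petals_node_splitting: "node_splitting D UNIV petals"
proof -
  have "\<Union> petals = UNIV" "{} \<notin> petals"
    unfolding petals_def using same_refl by blast+
  moreover have "S \<inter> T = {}" if "S \<in> petals" "T \<in> petals" "S \<noteq> T" for S T
    using petal_eqI[OF that(1,2) _ _ same_refl] that(3) by blast
  ultimately have part: "partition_on UNIV petals"
    unfolding partition_on_def disjoint_def by blast
  have in_sector: "D a b c d"
    if "S \<in> petals" "a \<in> S" "b \<in> S" "c \<in> UNIV - S" "d \<in> UNIV - S" for S a b c d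
    using that same_D_not_same[of a b c d] petalD[OF that(1,2)] by blast
  have across: "\<not> D a b c d"
    if "S1 \<in> petals" "S2 \<in> petals" "S3 \<in> petals" "S4 \<in> petals" "distinct [S1, S2, S3, S4]"
      "a \<in> S1" "b \<in> S2" "c \<in> S3" "d \<in> S4" for S1 S2 S3 S4 a b c d
  proof (rule not_same_not_D)
    show "\<not> a \<approx> b" using petal_eqI[OF that(1,2,6,7)] that(5) by auto
    show "\<not> c \<approx> d" using petal_eqI[OF that(3,4,8,9)] that(5) by auto
  qed
  obtain i :: 'i where True by simp
  obtain j where j: "j \<noteq> i" using fresh_index[of "{i}"] by auto
  obtain k where k: "k \<noteq> i" "k \<noteq> j" using fresh_index[of "{i, j}"] by auto
  define P where "P p = {y. t p \<approx> y}" for p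
  have P: "P p \<in> petals" for p unfolding petals_def P_def by (rule rangeI)
  have ne: "P p \<noteq> P q" if "p \<noteq> q" for p q
  proof
    assume "P p = P q"
    then have "t q \<in> P p" using same_refl by (simp add: P_def)
    then show False using same_terms that by (simp add: P_def)
  qed
  have "\<exists>S\<in>petals. \<exists>T\<in>petals. \<exists>R\<in>petals. distinct [S, T, R]"
    by (intro bexI[of _ "P i"] bexI[of _ "P j"] bexI[of _ "P k"]) (use P ne j k in auto)
  moreover have "\<exists>S\<in>petals. \<exists>T\<in>petals. S \<noteq> T"
    by (intro bexI[of _ "P i"] bexI[of _ "P j"]) (use P ne j in auto)
  ultimately show ?thesis
    unfolding node_splitting_def splitting_def
    by (intro conjI ballI impI) (use part in_sector across in \<open>assumption | rule part | blast\<close>)+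
qed

lemma petals_trace: "(\<lambda>S. S \<inter> range t) ` petals - {{}} = {{t i} |i. True}"
proof -
  have 1: "{y. t i \<approx> y} \<inter> range t = {t i}" for i
    using same_terms by auto
  have "S \<inter> range t \<in> {{t i} |i. True}" if S: "S \<in> petals" "S \<inter> range t \<noteq> {}" for S
  proof -
    obtain i where "t i \<in> S" using S(2) by blast
    then have "S \<inter> range t = {t i}" using petalD[OF S(1)] 1 by blast
    then show ?thesis by blast
  qed
  moreover have "{t i} \<in> (\<lambda>S. S \<inter> range t) ` petals" for i
    using 1[of i] unfolding petals_def by blast
  ultimately show ?thesis by auto
qed

text \<open>The trace condition puts at most one term into each sector, so two terms avoid any given
  sector and (i) shows its elements equivalent. Conversely, if equivalent x, y lay in different
  sectors, their witnesses would either complete four distinct sectors, against (ii), or share a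
  sector with x or y, where (i) gives the opposite pairing.\<close>

lemma node_splitting_unique:
  assumes Q: "node_splitting D UNIV Q" and tr: "(\<lambda>S. S \<inter> range t) ` Q - {{}} = {{t i} |i. True}"
  shows "Q = petals"
proof -
  have part: "partition_on UNIV Q"
    and in_sector: "\<And>S a b c d. S \<in> Q \<Longrightarrow> a \<in> S \<Longrightarrow> b \<in> S \<Longrightarrow> c \<notin> S \<Longrightarrow> d \<notin> S \<Longrightarrow> D a b c d"
    and across: "\<And>S1 S2 S3 S4 a b c d. S1 \<in> Q \<Longrightarrow> S2 \<in> Q \<Longrightarrow> S3 \<in> Q \<Longrightarrow> S4 \<in> Q \<Longrightarrow>
      distinct [S1, S2, S3, S4] \<Longrightarrow> a \<in> S1 \<Longrightarrow> b \<in> S2 \<Longrightarrow> c \<in> S3 \<Longrightarrow> d \<in> S4 \<Longrightarrow> \<not> D a b c d"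
    using Q unfolding node_splitting_def splitting_def by simp_all
  have cover: "\<exists>S\<in>Q. x \<in> S" for x using partition_onD1[OF part] by blast
  have uniq: "S = T" if "S \<in> Q" "T \<in> Q" "x \<in> S" "x \<in> T" for S T x
    using disjointD[OF partition_onD2[OF part]] that by blast
  have one: "i = j" if "S \<in> Q" "t i \<in> S" "t j \<in> S" for S i j
  proof -
    have "S \<inter> range t \<in> (\<lambda>S. S \<inter> range t) ` Q - {{}}" using that by blast
    then obtain k where k: "S \<inter> range t = {t k}" unfolding tr by blast
    have "t i \<in> S \<inter> range t" "t j \<in> S \<inter> range t" using that by blast+
    then show ?thesis unfolding k by (simp add: t_eq_iff)
  qed
  have sector: "y \<in> S \<longleftrightarrow> x \<approx> y" if S: "S \<in> Q" "x \<in> S" for S x y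
  proof
    assume y: "y \<in> S"
    have fin: "finite {i. t i \<in> S}" 
    proof (cases "\<exists>i. t i \<in> S")
      case True
      then obtain i where "t i \<in> S" by blast
      then have "{i. t i \<in> S} \<subseteq> {i}" using one[OF S(1)] by blast
      then show ?thesis using finite_subset by blast
    qed simp
    obtain i where i: "t i \<notin> S" using fresh_index[OF fin] by blast
    obtain j where "t j \<notin> S" "j \<noteq> i" using fresh_index[of "insert i {i. t i \<in> S}"] fin by auto
    then show "x \<approx> y" using in_sector[OF S y i] sameI by metis
  next
    assume "x \<approx> y"
    then obtain i j where ij: "i \<noteq> j" and D: "D x y (t i) (t j)" by (rule sameE)
    show "y \<in> S"
    proof (rule ccontr)
      assume nS: "y \<notin> S"
      obtain T where T: "T \<in> Q" "y \<in> T" using cover by blast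
      obtain Si Sj where Si: "Si \<in> Q" "t i \<in> Si" and Sj: "Sj \<in> Q" "t j \<in> Sj" using cover by blast
      have "Si \<noteq> Sj" using one Si Sj ij by blast
      have ST: "S \<noteq> T" using nS T by blast
      have *: False if "u \<in> R" "t p \<in> R" "R \<in> Q" "v \<notin> R" "t q \<notin> R" "D u v (t p) (t q)" for u v p q R
        using in_sector[OF that(3,1,2,4,5)] D_incompatible(1)[OF that(6)] by blast
      show False
      proof (cases "distinct [S, T, Si, Sj]")
        case True
        then show False using across[OF S(1) T(1) Si(1) Sj(1) True S(2) T(2) Si(2) Sj(2)] D by blast
      next
        case False
        then consider "S = Si" | "S = Sj" | "T = Si" | "T = Sj" using ST \<open>Si \<noteq> Sj\<close> by auto
        then show False
        proof cases
          case 1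
          then have "t j \<notin> S" using one[of S i j] Si(2) S(1) ij by blast
          then show False using *[of x S i y j] 1 S Si nS D by blast
        next
          case 2
          then have "t i \<notin> S" using one[of S i j] Sj(2) S(1) ij by blast
          then show False using *[of x S j y i] 2 S Sj nS D D_swap_right by blast
        next
          case 3
          then have "t j \<notin> T" using one[of T i j] Si(2) T(1) ij by blast
          moreover have "x \<notin> T" using uniq[OF S(1) T(1) S(2)] ST by blast
          ultimately show False using *[of y T i x j] 3 T Si D D_swap_left by blast
        next
          case 4
          then have "t i \<notin> T" using one[of T i j] Sj(2) T(1) ij by blast
          moreover have "x \<notin> T" using uniq[OF S(1) T(1) S(2)] ST by blast
          ultimately show False using *[of y T j x i] 4 T Sj D D_swap_left D_swap_right by blast
        qed
      qed
    qed
  qed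
  have ne: "S \<noteq> {}" if "S \<in> Q" for S using partition_onD3[OF part] that by blast
  have "S \<in> petals" if S: "S \<in> Q" for S
  proof -
    obtain x where "x \<in> S" using ne[OF S] by blast
    then have "S = {y. x \<approx> y}" using sector[OF S] by blast
    then show ?thesis unfolding petals_def by blast
  qed
  moreover have "{y. x \<approx> y} \<in> Q" for x
  proof -
    obtain S where "S \<in> Q" "x \<in> S" using cover by blast
    then have "{y. x \<approx> y} = S" using sector by blast
    then show ?thesis using \<open>S \<in> Q\<close> by simp
  qed
  ultimately show ?thesis unfolding petals_def by blast
qed

text \<open>Membership becomes a relation between x and three terms, a form that can be denied for a
  parameter outside the hull.\<close>

lemma petal_hull_eq: "petal_hull D t = {x. \<exists>i j k. j \<noteq> k \<and> D x (t i) (t j) (t k)}"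
proof -
  have "node_extension D (range t) {{t i} |i. True} = petals"
    unfolding node_extension_def
    by (rule the_equality, rule conjI[OF petals_node_splitting petals_trace],
        elim conjE, rule node_splitting_unique)
  moreover have "x \<in> \<Union> {S \<in> petals. S \<inter> range t \<noteq> {}} \<longleftrightarrow> (\<exists>i. x \<approx> t i)" for x
  proof
    assume "x \<in> \<Union> {S \<in> petals. S \<inter> range t \<noteq> {}}"
    then obtain S i where "S \<in> petals" "x \<in> S" "t i \<in> S" by blast
    then show "\<exists>i. x \<approx> t i" using petalD by blast
  next
    assume "\<exists>i. x \<approx> t i"
    then obtain i where "t i \<in> {y. x \<approx> y}" by blast
    moreover have "{y. x \<approx> y} \<in> petals" unfolding petals_def by (rule rangeI)
    ultimately show "x \<in> \<Union> {S \<in> petals. S \<inter> range t \<noteq> {}}" using same_refl by blast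
  qed
  ultimately have "petal_hull D t = {x. \<exists>i. x \<approx> t i}"
    unfolding petal_hull_def by (simp add: set_eq_iff)
  then show ?thesis unfolding same_petal_def by simp
qed

end

section \<open>From indiscernibility for formulas to invariance of \<open>D\<close>\<close>

lemma indiscernible_D:
  fixes s :: "nat \<Rightarrow> 'i::linorder \<Rightarrow> 'a"
  assumes ind: "indiscernible D L U n s"
    and k: "k1 \<in> {1..n}" "k2 \<in> {1..n}" "k3 \<in> {1..n}" "k4 \<in> {1..n}"
    and ord: "ord_eq [i1, i2, i3, i4] [j1, j2, j3, j4]"
  shows "D (s k1 i1) (s k2 i2) (s k3 i3) (s k4 i4) \<longleftrightarrow>
    D (s k1 j1) (s k2 j2) (s k3 j3) (s k4 j4)"
proof -
  \<comment> \<open>Formulas are evaluated at strictly increasing indices, so repeated indices are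
    merged: \<open>P\<close> holds each pair of old and new index once, and the four variables refer
    to its elements by rank.\<close>
  define P where "P = set (zip [i1, i2, i3, i4] [j1, j2, j3, j4])"
  define A where "A = fst ` P"
  define A' where "A' = snd ` P"
  have fin: "finite P" "finite A" "finite A'" by (auto simp: P_def A_def A'_def)
  have lt: "fst p < fst q \<longleftrightarrow> snd p < snd q" if "p \<in> P" "q \<in> P" for p q
    using ord that unfolding ord_eq_def P_def by blast
  \<comment> \<open>Strict order is compared in both directions, so equality of indices carries over
    as well.\<close>
  have eq: "fst p = fst q \<longleftrightarrow> snd p = snd q" if "p \<in> P" "q \<in> P" for p q
    using lt[of p q] lt[of q p] that by (metis linorder_neq_iff)
  have inj: "inj_on fst P" "inj_on snd P"
    using eq by (auto simp: inj_on_def prod_eq_iff)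
  have card: "card A = card P" "card A' = card P"
    using inj by (auto simp: A_def A'_def card_image)
  \<comment> \<open>Tuple arguments count from 1 and list positions from 0, hence
    \<open>r - 1\<close>. The rank is one more than the number of smaller indices, and by
    \<open>lt\<close> this number agrees on both sides.\<close>
  have rank: "\<exists>r. r \<in> {1..card P} \<and> sorted_list_of_set A ! (r - 1) = fst p
      \<and> sorted_list_of_set A' ! (r - 1) = snd p" if p: "p \<in> P" for p
  proof -
    have at: "sorted_list_of_set X ! card {y\<in>X. y < x} = x \<and> card {y\<in>X. y < x} < card X"
      if X: "finite X" "x \<in> X" for X and x :: 'i
    proof -
      let ?xs = "sorted_list_of_set X"
      obtain m where m: "m < length ?xs" "?xs ! m = x"
        using X by (metis in_set_conv_nth set_sorted_list_of_set)
      have sd: "sorted_wrt (<) ?xs" by simp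
      have "{y\<in>X. y < x} = (!) ?xs ` {..<m}"
      proof safe
        fix y assume "y \<in> X" "y < x"
        then obtain l where l: "l < length ?xs" "?xs ! l = y"
          using X by (metis in_set_conv_nth set_sorted_list_of_set)
        have "l < m"
        proof (rule ccontr)
          assume "\<not> l < m"
          then have "x \<le> y" using sorted_nth_mono[of ?xs m l] l m by simp
          then show False using \<open>y < x\<close> by simp
        qed
        then show "y \<in> (!) ?xs ` {..<m}" using l by blast
      next
        fix l assume "l < m"
        then show "?xs ! l \<in> X" 
          using m(1) X by (metis nth_mem order.strict_trans set_sorted_list_of_set)
        show "?xs ! l < x" using sorted_wrt_nth_less[OF sd \<open>l < m\<close> m(1)] m(2) by simp
      qed
      moreover have "inj_on ((!) ?xs) {..<m}"
        using m(1) by (intro inj_on_nth) auto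
      ultimately have "card {y\<in>X. y < x} = m" by (simp add: card_image)
      then show ?thesis using m by simp
    qed
    have "{y\<in>A. y < fst p} = fst ` {q\<in>P. fst q < fst p}" "{y\<in>A'. y < snd p} = snd ` {q\<in>P. snd q < snd p}"
      by (auto simp: A_def A'_def)
    moreover have "{q\<in>P. snd q < snd p} = {q\<in>P. fst q < fst p}" using lt[OF _ p] by blast
    moreover have "inj_on fst {q\<in>P. fst q < fst p}" "inj_on snd {q\<in>P. fst q < fst p}"
      using inj by (auto intro: inj_on_subset)
    ultimately have c: "card {y\<in>A'. y < snd p} = card {y\<in>A. y < fst p}"
      by (simp add: card_image)
    have "fst p \<in> A" "snd p \<in> A'" using p by (auto simp: A_def A'_def)
    then show ?thesis
      using at[OF fin(2), of "fst p"] at[OF fin(3), of "snd p"] c card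
      by (intro exI[of _ "Suc (card {y\<in>A. y < fst p})"]) auto
  qed
  have mem: "(i1, j1) \<in> P" "(i2, j2) \<in> P" "(i3, j3) \<in> P" "(i4, j4) \<in> P" by (auto simp: P_def)
  define f where "f r = sorted_list_of_set A ! (r - 1)" for r
  define g where "g r = sorted_list_of_set A' ! (r - 1)" for r
  obtain r1 where r1: "r1 \<in> {1..card P}" "f r1 = i1" "g r1 = j1" using rank[OF mem(1)] by (auto simp: f_def g_def)
  obtain r2 where r2: "r2 \<in> {1..card P}" "f r2 = i2" "g r2 = j2" using rank[OF mem(2)] by (auto simp: f_def g_def)
  obtain r3 where r3: "r3 \<in> {1..card P}" "f r3 = i3" "g r3 = j3" using rank[OF mem(3)] by (auto simp: f_def g_def)
  obtain r4 where r4: "r4 \<in> {1..card P}" "f r4 = i4" "g r4 = j4" using rank[OF mem(4)] by (auto simp: f_def g_def)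
  have mono: "strict_mono_on {1..card P} (\<lambda>r. sorted_list_of_set X ! (r - 1))" if "card X = card P" for X :: "'i set"
    using that by (auto simp: strict_mono_on_def intro!: sorted_wrt_nth_less[where P = "(<)"])
  define \<phi> :: "('b, nat \<times> nat) fm" where "\<phi> = Rel (r1, k1) (r2, k2) (r3, k3) (r4, k4)"
  have "sat D U (\<lambda>(r, k). s k (f r)) \<phi> \<longleftrightarrow> sat D U (\<lambda>(r, k). s k (g r)) \<phi>"
    using ind[unfolded indiscernible_def, rule_format, of \<phi> "card P" f g] mono card r1 r2 r3 r4 k
    by (auto simp: \<phi>_def f_def[abs_def] g_def[abs_def])
  then show ?thesis by (simp add: \<phi>_def r1 r2 r3 r4)
qed

section \<open>Replacing one argument, along a line and around a node\<close>

context D_set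
begin

text \<open>The elements h and u mark the two ends beyond i, j. If the move fails, (D3) gives iy|zj
  and iy|wj, so neither z nor w is at the end of y. Hence z and w share the other end, ij|zw holds,
  and transitivity completes the move after all.\<close>

lemma move_through_line:
  assumes y: "D y h i j \<or> D y u i j" and z: "D z h i j \<or> D z u i j" and w: "D w h i j \<or> D w u i j"
    and D: "D i y z w"
  shows "D j y z w"
proof (rule ccontr)
  assume not: "\<not> D j y z w"
  have iz: "D i y z j" and iw: "D i y w j"
    using D_subst14[OF D, of j] D_subst13[OF D, of j] not D_swap_right by blast+
  have no: "\<not> D y z i j" "\<not> D y w i j"
    using D_incompatible[OF iz] D_incompatible[OF iw] by blast+
  have far: "D z w i j"
  proof -
    have *: "D p q i j" if "D p v i j" "D q v i j" for p q v
      using D_trans[OF that(1)] that(2) D_swap_left by blast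
    from y show ?thesis
      using z w no *[of y h z] *[of y h w] *[of y u z] *[of y u w] *[of z h w] *[of z u w] by argo
  qed
  have "D j i z w" using far D_swap_sides D_swap_left by metis
  then show False using D_trans[OF _ D] not by blast
qed

text \<open>If the move fails, (D3) gives iy|zj. Passing i and j one after the other through the
  spare petal k exchanges them, which yields jy|zi, a different pairing.\<close>

lemma move_through_node:
  assumes y: "\<not> D y i j k" "\<not> D y j i k" "\<not> D y k i j"
    and z: "\<not> D z i j k" "\<not> D z j i k" "\<not> D z k i j"
    and D: "D i y z w"
  shows "D j y z w"
proof (rule ccontr)
  assume not: "\<not> D j y z w"
  have 1: "D i y z j" using D_subst14[OF D, of j] not by blast
  have 2: "D k y z j"
    using D_subst13[OF 1, of k] y(1) D_swap_left D_swap_right by metis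
  have 3: "D k y z i"
    using D_subst24[OF 2, of i] z(2) D_swap_left D_swap_right D_swap_sides by metis
  have 4: "D j y z i"
    using D_subst13[OF 3, of j] y(3) D_swap_left D_swap_right by metis
  show False using D_incompatible[OF 1] 4 by blast
qed

lemma no_D_among:
  assumes no: "\<not> D a b c d" "\<not> D a c b d" "\<not> D a d b c"
    and F: "w \<in> {a, b, c, d}" "x \<in> {a, b, c, d}" "y \<in> {a, b, c, d}" "z \<in> {a, b, c, d}"
    and dist: "distinct [w, x, y, z]"
  shows "\<not> D w x y z"
proof -
  have perms: "\<not> D p q r u \<and> \<not> D q p r u \<and> \<not> D p q u r \<and> \<not> D q p u r \<and>
      \<not> D r u p q \<and> \<not> D u r p q \<and> \<not> D r u q p \<and> \<not> D u r q p" if "\<not> D p q r u" for p q r u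
    using that D_swap_left D_swap_right D_swap_sides by blast
  show ?thesis
    using F dist perms[OF no(1)] perms[OF no(2)] perms[OF no(3)] by auto
qed

end

section \<open>Component sequences: classification, and the location of terms and parameters\<close>

locale indiscernible_family = D_set D for D :: "'a \<Rightarrow> 'a \<Rightarrow> 'a \<Rightarrow> 'a \<Rightarrow> bool" +
  fixes S :: "('i::{linorder, no_bot, no_top} \<Rightarrow> 'a) set"
  assumes D_order_invariant:
    "\<lbrakk>c1 \<in> S; c2 \<in> S; c3 \<in> S; c4 \<in> S; ord_eq [i1, i2, i3, i4] [j1, j2, j3, j4]\<rbrakk> \<Longrightarrow>
       D (c1 i1) (c2 i2) (c3 i3) (c4 i4) \<longleftrightarrow> D (c1 j1) (c2 j2) (c3 j3) (c4 j4)"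
begin

lemma D_move:
  "\<lbrakk>c1 \<in> S; c2 \<in> S; c3 \<in> S; c4 \<in> S; D (c1 i1) (c2 i2) (c3 i3) (c4 i4);
    ord_eq [i1, i2, i3, i4] [j1, j2, j3, j4]\<rbrakk> \<Longrightarrow> D (c1 j1) (c2 j2) (c3 j3) (c4 j4)"
  using D_order_invariant by blast

lemma ex_below: "finite A \<Longrightarrow> \<exists>h::'i. \<forall>a\<in>A. h < a"
proof (induction rule: finite_induct)
  case (insert x F)
  then obtain h where "\<forall>a\<in>F. h < a" by blast
  moreover obtain h' where "h' < min h x" using lt_ex by blast
  ultimately show ?case by (intro exI[of _ h']) auto
qed simp

lemma ex_above: "finite A \<Longrightarrow> \<exists>u::'i. \<forall>a\<in>A. a < u"
proof (induction rule: finite_induct)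
  case (insert x F)
  then obtain h where "\<forall>a\<in>F. a < h" by blast
  moreover obtain h' where "max h x < h'" using gt_ex by blast
  ultimately show ?case by (intro exI[of _ h']) auto
qed simp

lemma infinite_index: "infinite (UNIV :: 'i set)"
  using ex_above by blast

text \<open>Equality of terms is visible to \<open>D\<close>: by \<open>D_refl\<close>, aa|cc holds
  exactly when a and c differ.\<close>

lemma constant_or_inj:
  assumes t: "t \<in> S"
  shows "constant_seq t \<or> inj t"
proof -
  have eq: "t i = t j \<longleftrightarrow> t i' = t j'" if "i < j" "i' < j'" for i j i' j'
  proof -
    have "D (t i) (t i) (t j) (t j) \<longleftrightarrow> D (t i') (t i') (t j') (t j')"
      using that by (intro D_order_invariant t) (auto simp: ord_eq_def)
    then show ?thesis by (simp add: D_refl)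
  qed
  show ?thesis
  proof (cases "\<exists>i j. i < j \<and> t i = t j")
    case True
    then have "t i = t j" if "i < j" for i j using eq that by blast
    then show ?thesis unfolding constant_seq_def by (metis linorder_neq_iff)
  next
    case False
    then show ?thesis unfolding inj_def by (metis linorder_neq_iff)
  qed
qed

lemma inj_not_constant: "inj (t :: 'i \<Rightarrow> 'a) \<Longrightarrow> \<not> constant_seq t"
  unfolding constant_seq_def inj_def by (metis lt_ex order_less_irrefl)

text \<open>A fifth index e above d makes either crossing contradict itself: ac|bd shifts to ac|be
  and ad|ce, while transitivity gives ac|de; ad|bc shifts to ae|bc and be|cd, while transitivity
  gives de|bc.\<close>

lemma no_cross:
  assumes t: "t \<in> S" and ord: "a < b" "b < c" "c < d"
  shows "\<not> D (t a) (t c) (t b) (t d)" "\<not> D (t a) (t d) (t b) (t c)"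
proof -
  obtain e where e: "d < e" using gt_ex by blast
  note ord = ord e
  show "\<not> D (t a) (t c) (t b) (t d)"
  proof
    assume 1: "D (t a) (t c) (t b) (t d)"
    have 2: "D (t a) (t c) (t b) (t e)"
      by (rule D_move[OF t t t t 1]) (use ord in \<open>auto simp: ord_eq_def\<close>)
    have 3: "D (t a) (t d) (t c) (t e)"
      by (rule D_move[OF t t t t 1]) (use ord in \<open>auto simp: ord_eq_def\<close>)
    have "D (t a) (t c) (t d) (t e)"
      using D_trans_right[OF _ 2] 1 D_swap_right by blast
    then show False using 3 D_incompatible(1) by blast
  qed
  show "\<not> D (t a) (t d) (t b) (t c)"
  proof
    assume 1: "D (t a) (t d) (t b) (t c)"
    have 2: "D (t a) (t e) (t b) (t c)"
      by (rule D_move[OF t t t t 1]) (use ord in \<open>auto simp: ord_eq_def\<close>)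
    have 3: "D (t b) (t e) (t c) (t d)"
      by (rule D_move[OF t t t t 1]) (use ord in \<open>auto simp: ord_eq_def\<close>)
    have "D (t d) (t e) (t b) (t c)"
      using D_trans[OF _ 2] 1 D_swap_left by blast
    then show False using D_incompatible[OF 3] by blast
  qed
qed

text \<open>By \<open>no_cross\<close>, the only possible relation among four terms in increasing
  order is the sorted one ab|cd, and by invariance it holds for all increasing quadruples or for
  none.\<close>

lemma sequence_cases:
  assumes t: "t \<in> S"
  obtains "constant_seq t" | "\<not> constant_seq t" "petaled D t" | "\<not> constant_seq t" "\<not> petaled D t" "monotonic D t"
proof -
  have "petaled D t" if inj: "inj t" and not: "\<not> monotonic D t"
  proof -
    obtain a b c d where abcd: "a < b" "b < c" "c < d" "\<not> D (t a) (t b) (t c) (t d)"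
      using inj not unfolding monotonic_def by blast
    have no: "\<not> D (t i) (t j) (t k) (t l)" if "i < j" "j < k" "k < l" for i j k l
    proof
      assume 1: "D (t i) (t j) (t k) (t l)"
      have "D (t a) (t b) (t c) (t d)"
        by (rule D_move[OF t t t t 1]) (use abcd(1-3) that in \<open>auto simp: ord_eq_def\<close>)
      then show False using abcd(4) by blast
    qed
    have sorted: "\<not> D (t i) (t j) (t k) (t l)" if o: "i < j" "k < l" "i < k" "j \<noteq> k" "j \<noteq> l" for i j k l
    proof -
      consider "j < k" | "k < j" "j < l" | "l < j" using o by fastforce
      then show ?thesis
        by cases (use no no_cross[OF t] o in auto)
    qed
    have sorted': "\<not> D (t i) (t j) (t k) (t l)" if "i < j" "k < l" "i \<noteq> k" "j \<noteq> k" "j \<noteq> l" "i \<noteq> l" for i j k l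
      using sorted[of i j k l] sorted[of k l i j] that D_swap_sides[of "t i" "t j" "t k" "t l"]
      by (cases "i < k") auto
    have "\<not> D (t i) (t j) (t k) (t l)" if "distinct [i, j, k, l]" for i j k l
      using sorted'[of i j k l] sorted'[of j i k l] sorted'[of i j l k] sorted'[of j i l k] that
        D_swap_left[of "t i" "t j"] D_swap_right[of _ _ "t k" "t l"]
      by (cases "i < j"; cases "k < l") (auto simp: not_less order_le_less)
    then show ?thesis using inj unfolding petaled_def by blast
  qed
  then show thesis using constant_or_inj[OF t] inj_not_constant that by blast
qed

lemma monotonic_D: "monotonic D (t :: 'i \<Rightarrow> 'a) \<Longrightarrow> i < j \<Longrightarrow> j < k \<Longrightarrow> k < l \<Longrightarrow> D (t i) (t j) (t k) (t l)"
  unfolding monotonic_def by blast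

text \<open>Let r < i and u < d. Applied to ij|ud, (D3) puts \<open>c r\<close> with u away from i,
  j, or else with j away from u, d. In the second case transitivity allows h in place of j, and the
  pair u, d can be pulled back to i, j, both being above r. The case j < r is the mirror
  image.\<close>

lemma term_located_line:
  assumes t: "t \<in> S" "monotonic D t" and c: "c \<in> S"
    and ord: "h < i" "i < j" "j < u" "h < r" "r < u" "r < i \<or> j < r"
  shows "D (c r) (t h) (t i) (t j) \<or> D (c r) (t u) (t i) (t j)"
  using ord(6)
proof
  assume r: "r < i"
  obtain d where d: "u < d" using gt_ex by blast
  have "D (t i) (t j) (t u) (t d)" using monotonic_D t ord d by blast
  then have "D (c r) (t j) (t u) (t d) \<or> D (t i) (t j) (t u) (c r)" using D_subst14 by blast
  then show ?thesis
  proof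
    assume 1: "D (c r) (t j) (t u) (t d)"
    have "D (t j) (t h) (t u) (t d)" using monotonic_D[of t h j u d] t ord d D_swap_left by auto
    with 1 have 2: "D (c r) (t h) (t u) (t d)" using D_trans by blast
    have "D (c r) (t h) (t i) (t j)"
      by (rule D_move[OF c t(1) t(1) t(1) 2]) (use ord d r in \<open>auto simp: ord_eq_def\<close>)
    then show ?thesis ..
  next
    assume "D (t i) (t j) (t u) (c r)"
    then have "D (c r) (t u) (t i) (t j)" using D_swap_sides D_swap_left by metis
    then show ?thesis ..
  qed
next
  assume r: "j < r"
  obtain d where d: "d < h" using lt_ex by blast
  have "D (t d) (t h) (t i) (t j)" using monotonic_D t ord d by blast
  then have "D (c r) (t h) (t i) (t j) \<or> D (t d) (t h) (t i) (c r)" using D_subst14 by blast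
  then show ?thesis
  proof
    assume "D (t d) (t h) (t i) (c r)"
    moreover have "D (t d) (t h) (t i) (t u)" using monotonic_D[of t d h i u] t ord d by auto
    ultimately have "D (t d) (t h) (c r) (t u)" using D_trans_right D_swap_right by metis
    then have 2: "D (c r) (t u) (t d) (t h)" using D_swap_sides by blast
    have "D (c r) (t u) (t i) (t j)"
      by (rule D_move[OF c t(1) t(1) t(1) 2]) (use ord d r in \<open>auto simp: ord_eq_def\<close>)
    then show ?thesis ..
  qed blast
qed

lemma petaled_not_D: "petaled D t \<Longrightarrow> distinct [i, j, k, l] \<Longrightarrow> \<not> D (t i) (t j) (t k) (t l)"
  unfolding petaled_def by blast

text \<open>A relation of \<open>c r\<close> with three terms survives moving one of the three past a neighbour;
  two instances combine to a relation between four terms of \<open>t\<close>.\<close>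

lemma term_located_node:
  assumes t: "t \<in> S" "petaled D t" and c: "c \<in> S"
    and ord: "i < j" "j < u" "r < u" "r < i \<or> j < r"
  shows "\<not> D (c r) (t i) (t j) (t u)" "\<not> D (c r) (t j) (t i) (t u)" "\<not> D (c r) (t u) (t i) (t j)"
proof -
  obtain v where v: "u < v" using gt_ex by blast
  obtain d where d: "d < i" "d < r" using ex_below[of "{i, r}"] by auto
  have two: False if "D (c r) (t p) (t k) (t l)" "D (c r) (t q) (t k) (t l)" "distinct [p, q, k, l]" for p q k l
    using petaled_not_D[OF t(2) that(3)] D_trans[of "t p" "c r" "t k" "t l" "t q"] that D_swap_left by blast
  note move = D_move[OF c t(1) t(1) t(1)]
  show "\<not> D (c r) (t u) (t i) (t j)"
  proof
    assume 1: "D (c r) (t u) (t i) (t j)"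
    have "D (c r) (t v) (t i) (t j)"
      by (rule move[OF 1]) (use ord v in \<open>auto simp: ord_eq_def\<close>)
    from two[OF 1 this] show False by (rule meta_mp) (use ord v in auto)
  qed
  show "\<not> D (c r) (t i) (t j) (t u)"
  proof
    assume 1: "D (c r) (t i) (t j) (t u)"
    from ord(4) show False
    proof
      assume r: "r < i"
      have 2: "D (c r) (t i) (t u) (t v)"
        by (rule move[OF 1]) (use ord v r in \<open>auto simp: ord_eq_def\<close>)
      have "D (c r) (t j) (t u) (t v)"
        by (rule move[OF 1]) (use ord v r in \<open>auto simp: ord_eq_def\<close>)
      from two[OF 2 this] show False by (rule meta_mp) (use ord v in auto)
    next
      assume r: "j < r"
      have "D (c r) (t d) (t j) (t u)"
        by (rule move[OF 1]) (use ord d r in \<open>auto simp: ord_eq_def\<close>)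
      from two[OF 1 this] show False by (rule meta_mp) (use ord d in auto)
    qed
  qed
  show "\<not> D (c r) (t j) (t i) (t u)"
  proof
    assume 1: "D (c r) (t j) (t i) (t u)"
    from ord(4) show False
    proof
      assume r: "r < i"
      have 2: "D (c r) (t j) (t i) (t v)"
        by (rule move[OF 1]) (use ord v r in \<open>auto simp: ord_eq_def\<close>)
      have "D (c r) (t u) (t i) (t v)"
        by (rule move[OF 1]) (use ord v r in \<open>auto simp: ord_eq_def\<close>)
      from two[OF 2 this] show False by (rule meta_mp) (use ord v in auto)
    next
      assume r: "j < r"
      have 2: "D (c r) (t j) (t d) (t u)"
        by (rule move[OF 1]) (use ord d r in \<open>auto simp: ord_eq_def\<close>)
      have "D (c r) (t i) (t d) (t u)"
        by (rule move[OF 1]) (use ord d r in \<open>auto simp: ord_eq_def\<close>)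
      from two[OF 2 this] show False by (rule meta_mp) (use ord d in auto)
    qed
  qed
qed

text \<open>Outside the range, \<open>H1\<close> and \<open>H2\<close>, b sides with the first or
  the last of any three increasing terms against the other two. If it is at neither end, then b
  t_j|t_h t_i and b t_i|t_j t_u, and (D3) turns these into the two conditions of
  \<open>H3\<close>.\<close>

lemma avoiding_line:
  assumes b: "b \<notin> hull1 D (t :: 'i \<Rightarrow> 'a)" and t: "\<not> constant_seq t" "\<not> petaled D t" "monotonic D t"
    and ord: "h < i" "i < j" "j < u"
  shows "D b (t h) (t i) (t j) \<or> D b (t u) (t i) (t j)"
proof (rule ccontr)
  assume no: "\<not> (D b (t h) (t i) (t j) \<or> D b (t u) (t i) (t j))"
  have b: "b \<notin> range t" "b \<notin> H1 D t" "b \<notin> H2 D t" "b \<notin> H3 D t"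
    using b t by (auto simp: hull1_def)
  have inj: "t p = t q \<longleftrightarrow> p = q" for p q using t(3) by (auto simp: monotonic_def inj_def)
  have tri: "D b (t p) (t q) (t r) \<or> D b (t r) (t p) (t q)" if pqr: "p < q" "q < r" for p q r
  proof (rule ccontr)
    assume not: "\<not> (D b (t p) (t q) (t r) \<or> D b (t r) (t p) (t q))"
    have H1: "\<not> D (t p) (t r) (t q) b"
      using b(2) pqr by (auto simp: H1_def)
    have *: "\<not> D (t p) (t q) (t r) b" "\<not> D (t p) b (t q) (t r)"
      using not D_swap_left D_swap_sides by metis+
    have "b \<in> H2 D t"
      unfolding H2_def Let_def
      by (intro CollectI exI[of _ p] exI[of _ q] exI[of _ r] conjI pqr ballI impI)
        (rule no_D_among[OF *(1) H1 *(2)])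
    then show False using b(3) by blast
  qed
  have 1: "D b (t j) (t h) (t i)" and 2: "D b (t i) (t j) (t u)"
    using tri[of h i j] tri[of i j u] ord no by blast+
  have "D (t h) (t i) (t u) b"
    using D_subst23[OF 1, of "t u"] D_incompatible[OF 2] D_swap_sides D_swap_right by metis
  moreover have "D (t h) b (t j) (t u)"
    using D_subst24[OF 2, of "t h"] D_incompatible[OF 1] D_swap_left by metis
  ultimately have "b \<in> H3 D t"
    unfolding H3_def using ord D_swap_right by blast
  then show False using b(4) by blast
qed

end

section \<open>Order-preserving rearrangements built from single moves\<close>

definition apart :: "'i::linorder \<Rightarrow> 'i \<Rightarrow> 'i \<Rightarrow> bool" where
  "apart r i j \<longleftrightarrow> r < i \<and> r < j \<or> i < r \<and> j < r"

text \<open>Passing through the minimum of the two first indices keeps each intermediate pair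
  increasing, and the minimum stays in \<open>G\<close> because it is one of the two.\<close>

lemma two_moves:
  fixes R :: "'i::linorder \<Rightarrow> 'i \<Rightarrow> bool"
  assumes "\<And>p p' q. p \<in> G \<Longrightarrow> p' \<in> G \<Longrightarrow> q \<in> G \<Longrightarrow> p < q \<Longrightarrow> p' < q \<Longrightarrow> R p q \<longleftrightarrow> R p' q"
    and "\<And>p q q'. p \<in> G \<Longrightarrow> q \<in> G \<Longrightarrow> q' \<in> G \<Longrightarrow> p < q \<Longrightarrow> p < q' \<Longrightarrow> R p q \<longleftrightarrow> R p q'"
    and G: "p \<in> G" "q \<in> G" "p' \<in> G" "q' \<in> G" and ord: "p < q" "p' < q'"
  shows "R p q \<longleftrightarrow> R p' q'"
proof -
  let ?m = "min p p'"
  have m: "?m \<in> G" "?m < q" "?m < q'" using G ord by (auto simp: min_def)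
  have "R p q \<longleftrightarrow> R ?m q" using assms(1) G ord m by blast
  also have "\<dots> \<longleftrightarrow> R ?m q'" using assms(2) G ord m by blast
  also have "\<dots> \<longleftrightarrow> R p' q'" using assms(1) G ord m by blast
  finally show ?thesis .
qed

text \<open>Lowering the first index and raising the last before the middle one moves leaves room
  for both positions of the middle index.\<close>

lemma three_moves:
  fixes R :: "'i::linorder \<Rightarrow> 'i \<Rightarrow> 'i \<Rightarrow> bool"
  assumes 1: "\<And>p p' q r. p < q \<Longrightarrow> p' < q \<Longrightarrow> q < r \<Longrightarrow> R p q r \<longleftrightarrow> R p' q r"
    and 2: "\<And>p q q' r. p < q \<Longrightarrow> p < q' \<Longrightarrow> q < r \<Longrightarrow> q' < r \<Longrightarrow> R p q r \<longleftrightarrow> R p q' r"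
    and 3: "\<And>p q r r'. p < q \<Longrightarrow> q < r \<Longrightarrow> q < r' \<Longrightarrow> R p q r \<longleftrightarrow> R p q r'"
    and ord: "p < q" "q < r" "p' < q'" "q' < r'"
  shows "R p q r \<longleftrightarrow> R p' q' r'"
proof -
  let ?m = "min p p'" and ?M = "max r r'"
  have m: "?m < q" "?m < q'" "q < ?M" "q' < ?M" using ord by (auto simp: min_def max_def)
  have "R p q r \<longleftrightarrow> R ?m q r" using 1 ord m by blast
  also have "\<dots> \<longleftrightarrow> R ?m q ?M" using 3 ord m by blast
  also have "\<dots> \<longleftrightarrow> R ?m q' ?M" using 2 ord m by blast
  also have "\<dots> \<longleftrightarrow> R ?m q' r'" using 3 ord m by blast
  also have "\<dots> \<longleftrightarrow> R p' q' r'" using 1 ord m by blast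
  finally show ?thesis .
qed

lemma apart_commute: "apart r i j \<longleftrightarrow> apart r j i"
  unfolding apart_def by blast

context indiscernible_family
begin

lemma avoiding_node:
  assumes b: "b \<notin> hull1 D (t :: 'i \<Rightarrow> 'a)" and t: "\<not> constant_seq t" "petaled D t" and "j \<noteq> k"
  shows "\<not> D b (t i) (t j) (t k)"
proof -
  interpret petaled_seq D t using t infinite_index by unfold_locales
  show ?thesis using b t assms(4) petal_hull_eq by (auto simp: hull1_def)
qed

end

section \<open>Invariance under single moves, with parameters outside the hull\<close>

locale avoiding_family = indiscernible_family D S
  for D :: "'a \<Rightarrow> 'a \<Rightarrow> 'a \<Rightarrow> 'a \<Rightarrow> bool" and S :: "('i::{linorder, no_bot, no_top} \<Rightarrow> 'a) set" +
  fixes B :: "'a set"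
  assumes avoids_hull: "b \<in> B \<Longrightarrow> t \<in> S \<Longrightarrow> b \<notin> hull1 D t"
begin

text \<open>A parameter is treated as one more component sequence, a constant one.\<close>

definition C :: "('i \<Rightarrow> 'a) set" where "C = S \<union> (\<lambda>b _. b) ` B"

lemma C_cases: 
  assumes "c \<in> C"
  obtains "c \<in> S" | b where "b \<in> B" "c = (\<lambda>_. b)"
  using assms unfolding C_def by blast

lemma C_not_S: "c \<in> C \<Longrightarrow> c \<notin> S \<Longrightarrow> \<exists>b\<in>B. c = (\<lambda>_. b)"
  unfolding C_def by blast

lemma S_C: "c \<in> S \<Longrightarrow> c \<in> C" and B_C: "b \<in> B \<Longrightarrow> (\<lambda>_. b) \<in> C"
  unfolding C_def by auto

lemma located_line:
  assumes t: "t \<in> S" "\<not> constant_seq t" "\<not> petaled D t" "monotonic D t" and c: "c \<in> C"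
    and ord: "h < i" "i < j" "j < u" "h < r" "r < u" "r < i \<or> j < r"
  shows "D (c r) (t h) (t i) (t j) \<or> D (c r) (t u) (t i) (t j)"
  using c
proof (cases rule: C_cases)
  case 1
  show ?thesis by (rule term_located_line[OF t(1,4) 1 ord])
next
  case (2 b)
  then show ?thesis using avoiding_line[OF avoids_hull[OF 2(1) t(1)] t(2-4) ord(1-3)] by simp
qed

lemma located_node:
  assumes t: "t \<in> S" "\<not> constant_seq t" "petaled D t" and c: "c \<in> C"
    and ord: "i < j" "j < u" "r < u" "r < i \<or> j < r"
  shows "\<not> D (c r) (t i) (t j) (t u)" "\<not> D (c r) (t j) (t i) (t u)" "\<not> D (c r) (t u) (t i) (t j)"
proof -
  have "\<not> D (c r) (t i) (t j) (t u) \<and> \<not> D (c r) (t j) (t i) (t u) \<and> \<not> D (c r) (t u) (t i) (t j)"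
    using c
  proof (cases rule: C_cases)
    case 1
    show ?thesis using term_located_node[OF t(1,3) 1 ord] by blast
  next
    case (2 b)
    then show ?thesis using avoiding_node[OF avoids_hull[OF 2(1) t(1)] t(2,3)] ord by auto
  qed
  then show "\<not> D (c r) (t i) (t j) (t u)" "\<not> D (c r) (t j) (t i) (t u)" "\<not> D (c r) (t u) (t i) (t j)"
    by auto
qed

text \<open>The indices h and u are chosen outside all others: on a line they name the two ends, at
  a node u is the spare petal. Each direction is the same exchange with i and j swapped.\<close>

lemma single_move_aux:
  assumes t: "t \<in> S" and c: "c1 \<in> C" "c2 \<in> C" "c3 \<in> C" and ij: "i < j"
    and r: "r1 < i \<or> j < r1" "r2 < i \<or> j < r2" "r3 < i \<or> j < r3"
  shows "D (t i) (c1 r1) (c2 r2) (c3 r3) \<longleftrightarrow> D (t j) (c1 r1) (c2 r2) (c3 r3)"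
proof -
  obtain h where h: "h < i" "h < r1" "h < r2" "h < r3"
    using ex_below[of "{i, r1, r2, r3}"] by auto
  obtain u where u: "j < u" "r1 < u" "r2 < u" "r3 < u"
    using ex_above[of "{j, r1, r2, r3}"] by auto
  show ?thesis
  proof (cases rule: sequence_cases[OF t, case_names const petal line])
    case const
    then have "t i = t j" unfolding constant_seq_def by blast
    then show ?thesis by simp
  next
    case petal
    note l = located_node[OF t petal _ ij u(1)]
    have sw: "\<not> D y j i k \<and> \<not> D y i j k \<and> \<not> D y k j i"
      if "\<not> D y i j k" "\<not> D y j i k" "\<not> D y k i j" for y i j k
      using that D_swap_right by blast
    show ?thesis
      using move_through_node[of "c1 r1" "t i" "t j" "t u" "c2 r2" "c3 r3"]
        move_through_node[of "c1 r1" "t j" "t i" "t u" "c2 r2" "c3 r3"]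
        l[OF c(1) u(2) r(1)] l[OF c(2) u(3) r(2)] sw by blast
  next
    case line
    note l = located_line[OF t line _ h(1) ij u(1)]
    have sw: "D y h j i \<or> D y u j i" if "D y h i j \<or> D y u i j" for y h u i j
      using that D_swap_right by blast
    note l1 = l[OF c(1) h(2) u(2) r(1)] and l2 = l[OF c(2) h(3) u(3) r(2)] and l3 = l[OF c(3) h(4) u(4) r(3)]
    show ?thesis
      using move_through_line[OF l1 l2 l3] move_through_line[OF sw[OF l1] sw[OF l2] sw[OF l3]] by blast
  qed
qed

lemma single_move:
  assumes t: "t \<in> C" and c: "c1 \<in> C" "c2 \<in> C" "c3 \<in> C"
    and r: "apart r1 i j" "apart r2 i j" "apart r3 i j"
  shows "D (t i) (c1 r1) (c2 r2) (c3 r3) \<longleftrightarrow> D (t j) (c1 r1) (c2 r2) (c3 r3)"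
  using t
proof (cases rule: C_cases)
  case 1
  show ?thesis
  proof (cases i j rule: linorder_cases)
    case less
    then show ?thesis using single_move_aux[OF 1 c less] r by (auto simp: apart_def)
  next
    case greater
    then show ?thesis using single_move_aux[OF 1 c greater] r by (auto simp: apart_def)
  qed simp
qed simp

section \<open>Variables sharing an index\<close>

lemma pair_same_side:
  assumes c: "f \<in> C" "g \<in> C" "c \<in> C" "c' \<in> C" and r: "r < a \<or> d < r" "r' < a \<or> d < r'"
    and pq: "p \<in> {a..d}" "q \<in> {a..d}" "p' \<in> {a..d}" "q' \<in> {a..d}" "p < q" "p' < q'"
  shows "D (f p) (g q) (c r) (c' r') \<longleftrightarrow> D (f p') (g q') (c r) (c' r')"
proof (rule two_moves[OF _ _ pq, where R = "\<lambda>p q. D (f p) (g q) (c r) (c' r')"])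
  fix p p' q assume "p \<in> {a..d}" "p' \<in> {a..d}" "q \<in> {a..d}" "p < q" "p' < q"
  then show "D (f p) (g q) (c r) (c' r') \<longleftrightarrow> D (f p') (g q) (c r) (c' r')"
    using r by (intro single_move c) (auto simp: apart_def)
next
  fix p q q' assume o: "p \<in> {a..d}" "q \<in> {a..d}" "q' \<in> {a..d}" "p < q" "p < q'"
  have "D (g q) (f p) (c r) (c' r') \<longleftrightarrow> D (g q') (f p) (c r) (c' r')"
    using r o by (intro single_move c) (auto simp: apart_def)
  then show "D (f p) (g q) (c r) (c' r') \<longleftrightarrow> D (f p) (g q') (c r) (c' r')"
    using D_swap_left by metis
qed

lemma pair_between:
  assumes c: "f \<in> C" "g \<in> C" "c \<in> C" "c' \<in> C" and r: "r < a \<or> d < r" "r' < a \<or> d < r'"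
    and pq: "p \<in> {a..d}" "q \<in> {a..d}" "p' \<in> {a..d}" "q' \<in> {a..d}" "p < q" "p' < q'"
  shows "D (f p) (c r) (g q) (c' r') \<longleftrightarrow> D (f p') (c r) (g q') (c' r')"
proof (rule two_moves[OF _ _ pq, where R = "\<lambda>p q. D (f p) (c r) (g q) (c' r')"])
  fix p p' q assume "p \<in> {a..d}" "p' \<in> {a..d}" "q \<in> {a..d}" "p < q" "p' < q"
  then show "D (f p) (c r) (g q) (c' r') \<longleftrightarrow> D (f p') (c r) (g q) (c' r')"
    using r by (intro single_move c) (auto simp: apart_def)
next
  fix p q q' assume o: "p \<in> {a..d}" "q \<in> {a..d}" "q' \<in> {a..d}" "p < q" "p < q'"
  have "D (g q) (c' r') (f p) (c r) \<longleftrightarrow> D (g q') (c' r') (f p) (c r)"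
    using r o by (intro single_move c) (auto simp: apart_def)
  then show "D (f p) (c r) (g q) (c' r') \<longleftrightarrow> D (f p) (c r) (g q') (c' r')"
    using D_swap_sides by metis
qed

text \<open>Let z, w be the values \<open>c r\<close>, \<open>c' r'\<close>. If some spread version
  of the pair, such as x at a with y at d, faces z, w, transitivity carries it over to the tied
  pair. Otherwise x at a and d replaces z, w, and the formula speaks of terms only.\<close>

lemma tied_same_side_aux:
  assumes xy: "x \<in> S" "y \<in> S" and c: "c \<in> C" "c' \<in> C"
    and r: "r < a \<or> d < r" "r' < a \<or> d < r'" and ord: "a < i" "i < j" "j < d"
  shows "D (x i) (y i) (c r) (c' r') \<longleftrightarrow> D (x j) (y j) (c r) (c' r')"
proof -
  define z w where "z = c r" and "w = c' r'"
  define G where "G = {a..d}"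
  note xyC = xy[THEN S_C]
  have G: "a \<in> G" "i \<in> G" "j \<in> G" "d \<in> G" using ord by (auto simp: G_def)
  have inv: "D (f p) (g q) z w \<longleftrightarrow> D (f p') (g q') z w"
    if "f \<in> C" "g \<in> C" "p \<in> G" "q \<in> G" "p' \<in> G" "q' \<in> G" "p < q" "p' < q'" for f g p q p' q'
    unfolding z_def w_def using pair_same_side[OF that(1,2) c r] that(3-) unfolding G_def by blast
  have E: "e \<in> {i, j} \<Longrightarrow> e \<in> G \<and> a < e \<and> e < d \<and> a < d" for e using G ord by auto
  have all: "D (x e) (y e) z w" if "e \<in> {i, j}" "f \<in> C" "g \<in> C" "{f, g} = {x, y}" "D (f a) (g d) z w" for e f g
  proof -
    have "D (f a) (g e) z w" "D (f e) (g d) z w"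
      using inv[OF that(2,3), of a d a e] inv[OF that(2,3), of a d e d] G E[OF that(1)] that(5) by auto
    then have "D (f e) (g e) z w"
      using D_trans[of "f e" "g d" z w "f a"] D_trans[of "f e" "f a" z w "g e"] that(5) D_swap_left by blast
    then show ?thesis using that(4) D_swap_left by (auto simp: doubleton_eq_iff)
  qed
  \<comment> \<open>A single move would make such a relation true at both i and j, and transitivity
    would give x_i x_j|x_a x_d, against \<open>no_cross\<close>.\<close>
  have not_cross: "\<not> D (x e) v (x a) (x d)" if e: "e \<in> {i, j}" and v: "v = z \<or> v = w" for e v
  proof
    assume 1: "D (x e) v (x a) (x d)"
    have ap: "apart a i j" "apart d i j" "apart r i j" "apart r' i j" using ord r by (auto simp: apart_def)
    have "D (x i) v (x a) (x d) \<longleftrightarrow> D (x j) v (x a) (x d)"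
      using v single_move[OF xyC(1) c(1) xyC(1) xyC(1) ap(3,1,2)]
        single_move[OF xyC(1) c(2) xyC(1) xyC(1) ap(4,1,2)] unfolding z_def w_def by blast
    then have "D (x i) v (x a) (x d)" "D v (x j) (x a) (x d)" using 1 e D_swap_left by blast+
    then have "D (x i) (x j) (x a) (x d)" using D_trans by blast
    then show False using no_cross(2)[OF xy(1) ord] D_swap_sides by blast
  qed
  show ?thesis
  proof (cases "D (x a) (y d) z w \<or> D (y a) (x d) z w")
    case True
    then have "D (x e) (y e) z w" if "e \<in> {i, j}" for e
      using all[OF that xyC] all[OF that xyC(2,1)] by blast
    then show ?thesis unfolding z_def w_def by blast
  next
    case False
    \<comment> \<open>(D3) exchanges z, w for x_a, x_d one at a time. The alternative outcome is a
      spread pair facing z, w in one direction and a relation refuted by \<open>not_cross\<close> in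
      the other.\<close>
    have key: "D (x e) (y e) z w \<longleftrightarrow> D (x e) (y e) (x a) (x d)" if e: "e \<in> {i, j}" for e
    proof
      assume 1: "D (x e) (y e) z w"
      have "\<not> D (x a) (y e) z w" "\<not> D (y e) (x d) z w"
        using inv[OF xyC, of a d a e] inv[OF xyC(2,1), of a d e d] G E[OF e] False by auto
      then have "D (x e) (y e) z (x a)" "D (x e) (y e) z (x d)"
        using D_subst14[OF 1, of "x a"] D_subst14[OF 1, of "x d"] D_swap_left by blast+
      then show "D (x e) (y e) (x a) (x d)" using D_trans_right D_swap_right by blast
    next
      assume 1: "D (x e) (y e) (x a) (x d)"
      have "D (x e) (y e) (x a) z" "D (x e) (y e) (x a) w"
        using D_subst24[OF 1, of z] D_subst24[OF 1, of w] not_cross[OF e] by blast+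
      then show "D (x e) (y e) z w" using D_trans_right D_swap_right by blast
    qed
    have "D (x i) (y i) (x a) (x d) \<longleftrightarrow> D (x j) (y j) (x a) (x d)"
      using ord by (intro D_order_invariant xy) (auto simp: ord_eq_def)
    then show ?thesis using key[of i] key[of j] unfolding z_def w_def by blast
  qed
qed

text \<open>Write u < v for \<open>D u z v w\<close>, with z, w the values \<open>c r\<close>,
  \<open>c' r'\<close>. Since x_a < y_d but not x_d < y_a, x strictly increases, and both y_i and
  y_j lie between x_a and x_d. So \<open>caterpillar\<close> replaces z, w by x_a, x_d, and
  indiscernibility compares i with j.\<close>

lemma tied_between_increasing:
  assumes xy: "x \<in> S" "y \<in> S" and c: "c \<in> C" "c' \<in> C"
    and r: "r < a \<or> d < r" "r' < a \<or> d < r'" and ord: "a < i" "i < j" "j < d"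
    and up: "D (x a) (c r) (y d) (c' r')" and down: "\<not> D (x d) (c r) (y a) (c' r')"
  shows "D (x i) (c r) (y i) (c' r') \<longleftrightarrow> D (x j) (c r) (y j) (c' r')"
proof -
  define z w where "z = c r" and "w = c' r'"
  define G where "G = {a..d}"
  note xyC = xy[THEN S_C]
  have G: "a \<in> G" "i \<in> G" "j \<in> G" "d \<in> G" using ord by (auto simp: G_def)
  have inv: "D (f p) z (g q) w \<longleftrightarrow> D (f p') z (g q') w"
    if "f \<in> C" "g \<in> C" "p \<in> G" "q \<in> G" "p' \<in> G" "q' \<in> G" "p < q" "p' < q'" for f g p q p' q'
    unfolding z_def w_def using pair_between[OF that(1,2) c r] that(3-) unfolding G_def by blast
  have inv': "D (f q) z (g p) w \<longleftrightarrow> D (f q') z (g p') w"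
    if "f \<in> C" "g \<in> C" "p \<in> G" "q \<in> G" "p' \<in> G" "q' \<in> G" "p < q" "p' < q'" for f g p q p' q'
    using pair_between[OF that(2,1) c(2,1) r(2,1)] that(3-) D_swap_sides unfolding z_def w_def G_def by metis
  have lt: "a < j" "i < d" "a < d" using ord by auto
  have ai: "D (x a) z (y i) w" and aj: "D (x a) z (y j) w"
    using inv[OF xyC, of a d a i] inv[OF xyC, of a d a j] up G ord lt unfolding z_def w_def by auto
  have ji: "\<not> D (x j) z (y i) w"
    using inv'[OF xyC, of a d i j] down G ord lt unfolding z_def w_def by auto
  have xx: "D (x a) z (x j) w" using between_neg_trans[OF ai, of "x j"] ji by blast
  have xd: "D (x i) z (x d) w" "D (x j) z (x d) w" and xa: "D (x a) z (x i) w"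
    using xx inv[OF xyC(1) xyC(1), of a j i d] inv[OF xyC(1) xyC(1), of a j j d]
      inv[OF xyC(1) xyC(1), of a j a i] G ord lt by auto
  have yd: "D (y i) z (x d) w" using between_neg_trans[OF xd(2), of "y i"] ji by blast
  then have yd': "D (y j) z (x d) w"
    using inv[OF xyC(2,1), of i d j d] G ord lt by auto
  have "D (x i) z (y i) w \<longleftrightarrow> D (x a) (x i) (y i) (x d)"
    by (rule caterpillar[OF xa ai xd(1) yd])
  moreover have "D (x j) z (y j) w \<longleftrightarrow> D (x a) (x j) (y j) (x d)"
    by (rule caterpillar[OF xx aj xd(2) yd'])
  moreover have "D (x a) (x i) (y i) (x d) \<longleftrightarrow> D (x a) (x j) (y j) (x d)"
    using ord by (intro D_order_invariant xy) (auto simp: ord_eq_def)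
  ultimately show ?thesis unfolding z_def w_def by blast
qed

text \<open>In the same weak order, \<open>up\<close> compares an earlier x with a later y, and
  \<open>down\<close> a later x with an earlier y; single moves make both independent of the
  indices. If they agree, the tied formula takes their common value. If they differ, the increasing
  case applies, possibly with x, z exchanged for y, w.\<close>

lemma tied_between_aux:
  assumes xy: "x \<in> S" "y \<in> S" and c: "c \<in> C" "c' \<in> C"
    and r: "r < a \<or> d < r" "r' < a \<or> d < r'" and ord: "a < i" "i < j" "j < d"
  shows "D (x i) (c r) (y i) (c' r') \<longleftrightarrow> D (x j) (c r) (y j) (c' r')"
proof -
  define z w where "z = c r" and "w = c' r'"
  define G where "G = {a..d}"
  note xyC = xy[THEN S_C]
  have G: "a \<in> G" "i \<in> G" "j \<in> G" "d \<in> G" using ord by (auto simp: G_def)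
  have E: "e \<in> {i, j} \<Longrightarrow> e \<in> G \<and> a < e \<and> e < d \<and> a < d" for e using G ord by auto
  have inv: "D (f p) z (g q) w \<longleftrightarrow> D (f p') z (g q') w"
    if "f \<in> C" "g \<in> C" "p \<in> G" "q \<in> G" "p' \<in> G" "q' \<in> G" "p < q" "p' < q'" for f g p q p' q'
    unfolding z_def w_def using pair_between[OF that(1,2) c r] that(3-) unfolding G_def by blast
  have inv': "D (f q) z (g p) w \<longleftrightarrow> D (f q') z (g p') w"
    if "f \<in> C" "g \<in> C" "p \<in> G" "q \<in> G" "p' \<in> G" "q' \<in> G" "p < q" "p' < q'" for f g p q p' q'
    using pair_between[OF that(2,1) c(2,1) r(2,1)] that(3-) D_swap_sides unfolding z_def w_def G_def by metis
  \<comment> \<open>By \<open>inv\<close>, f_a < f_e is equivalent to f_e < f_d, so f_e cannot lie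
    above both f_a and f_d.\<close>
  have peak: False if e: "e \<in> {i, j}" and f: "f \<in> C" "D (f a) z (f e) w" "D (f d) z (f e) w" for e f
    using inv[OF f(1,1), of a e e d] between_asym[OF f(3)] E[OF e] f(2) G by blast
  define up where "up \<longleftrightarrow> D (x a) z (y d) w"
  define down where "down \<longleftrightarrow> D (x d) z (y a) w"
  have up: "D (x p) z (y q) w \<longleftrightarrow> up" if "p \<in> G" "q \<in> G" "p < q" for p q
    unfolding up_def using inv[OF xyC that(1,2) G(1,4) that(3)] ord by auto
  have down: "D (x q) z (y p) w \<longleftrightarrow> down" if "p \<in> G" "q \<in> G" "p < q" for p q
    unfolding down_def using inv'[OF xyC that(1,2) G(1,4) that(3)] ord by auto
  consider "up" "down" | "\<not> up" "\<not> down" | "up" "\<not> down" | "\<not> up" "down" by blast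
  then show ?thesis
  proof cases
    case 1
    have "D (x e) z (y e) w" if e: "e \<in> {i, j}" for e
    proof (rule ccontr)
      assume no: "\<not> D (x e) z (y e) w"
      have "D (x a) z (y e) w" "D (x d) z (y e) w"
        using up[of a e] down[of e d] 1 E[OF e] G by auto
      then show False
        using peak[OF e xyC(1)] between_neg_trans[of _ z "y e" w "x e"] no by blast
    qed
    then show ?thesis unfolding z_def w_def by blast
  next
    case 2
    have "\<not> D (x e) z (y e) w" if e: "e \<in> {i, j}" for e
    proof
      assume 1: "D (x e) z (y e) w"
      have "\<not> D (x e) z (y d) w" "\<not> D (x e) z (y a) w"
        using up[of e d] down[of a e] 2 E[OF e] G by auto
      then show False
        using peak[OF e xyC(2)] between_neg_trans[OF 1] by blast
    qed
    then show ?thesis unfolding z_def w_def by blast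
  next
    case 3
    then show ?thesis
      unfolding up_def down_def z_def w_def by (intro tied_between_increasing[OF xy c r ord])
  next
    case 4
    have "D (y a) (c' r') (x d) (c r)" "\<not> D (y d) (c' r') (x a) (c r)"
      using 4 D_swap_sides unfolding up_def down_def z_def w_def by blast+
    from tied_between_increasing[OF xy(2,1) c(2,1) r(2,1) ord this]
    show ?thesis using D_swap_sides by metis
  qed
qed


text \<open>Moving \<open>r\<close> away from \<open>i, j\<close> makes room on both sides, which a discrete index order need not
  offer at first.\<close>

lemma ex_room:
  assumes "apart r i j" "i < (j :: 'i)"
  obtains a d r' where "a < i" "j < d" "r' < a \<or> d < r'" "apart i r r'" "apart j r r'"
proof (cases "r < i")
  case True
  obtain a where a: "a < i" using lt_ex by blast
  obtain r' where r': "r' < a" using lt_ex by blast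
  obtain d where d: "j < d" using gt_ex by blast
  show thesis by (rule that[of a d r']) (use a r' d True assms in \<open>auto simp: apart_def\<close>)
next
  case False
  obtain a where a: "a < i" using lt_ex by blast
  obtain d where d: "j < d" using gt_ex by blast
  obtain r' where r': "d < r'" using gt_ex by blast
  show thesis by (rule that[of a d r']) (use a r' d False assms in \<open>auto simp: apart_def\<close>)
qed

text \<open>Moving r first makes the room that the spread pair needs. If x or y is a parameter, its
  constant sequence ignores the index, the tie disappears and a single move is enough.\<close>

lemma tied_same_side:
  assumes C: "x \<in> C" "y \<in> C" "c \<in> C" and b: "b \<in> B" and r: "apart r i j"
  shows "D (x i) (y i) (c r) b \<longleftrightarrow> D (x j) (y j) (c r) b"
proof -
  have less: "D (x i) (y i) (c r) b \<longleftrightarrow> D (x j) (y j) (c r) b" if xy: "x \<in> S" "y \<in> S" and ij: "i < j" and r: "apart r i j" for i j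
  proof -
    obtain a d r' where room: "a < i" "j < d" "r' < a \<or> d < r'" and ap: "apart i r r'" "apart j r r'"
      using ex_room[OF r ij] by blast
    have mv: "D (x k) (y k) (c r) b \<longleftrightarrow> D (x k) (y k) (c r') b" if "apart k r r'" for k
      using single_move[OF C(3) B_C[OF b] C(1,2) that that that] D_swap_sides by metis
    have "D (x i) (y i) (c r') b \<longleftrightarrow> D (x j) (y j) (c r') b"
      by (rule tied_same_side_aux[OF xy C(3) B_C[OF b] room(3,3,1) ij room(2)])
    then show ?thesis using mv ap by blast
  qed
  have const: "D (x i) (y i) (c r) b \<longleftrightarrow> D (x j) (y j) (c r) b" if "x = (\<lambda>_. v)" "x \<in> C" "y \<in> C" for v x y
    using single_move[OF that(3,2) C(3) B_C[OF b] r r r] that(1) D_swap_left[of v] by simp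
  show ?thesis
  proof (cases "x \<in> S \<and> y \<in> S")
    case True
    then show ?thesis
      using less[of i j] less[of j i] r apart_commute[of r i j]
      by (cases i j rule: linorder_cases) blast+
  next
    case False
    then obtain v where "x = (\<lambda>_. v) \<or> y = (\<lambda>_. v)" using C_not_S[OF C(1)] C_not_S[OF C(2)] by blast
    then show ?thesis using const[of x v y] const[of y v x] C(1,2) D_swap_left by blast
  qed
qed

lemma tied_between:
  assumes C: "x \<in> C" "y \<in> C" "c \<in> C" and b: "b \<in> B" and r: "apart r i j"
  shows "D (x i) (c r) (y i) b \<longleftrightarrow> D (x j) (c r) (y j) b"
proof -
  have less: "D (x i) (c r) (y i) b \<longleftrightarrow> D (x j) (c r) (y j) b" if xy: "x \<in> S" "y \<in> S" and ij: "i < j" and r: "apart r i j" for i j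
  proof -
    obtain a d r' where room: "a < i" "j < d" "r' < a \<or> d < r'" and ap: "apart i r r'" "apart j r r'"
      using ex_room[OF r ij] by blast
    have mv: "D (x k) (c r) (y k) b \<longleftrightarrow> D (x k) (c r') (y k) b" if "apart k r r'" for k
      using single_move[OF C(3,1,2) B_C[OF b] that that that] D_swap_left by metis
    have "D (x i) (c r') (y i) b \<longleftrightarrow> D (x j) (c r') (y j) b"
      by (rule tied_between_aux[OF xy C(3) B_C[OF b] room(3,3,1) ij room(2)])
    then show ?thesis using mv ap by blast
  qed
  show ?thesis
  proof (cases "x \<in> S \<and> y \<in> S")
    case True
    then show ?thesis
      using less[of i j] less[of j i] r apart_commute[of r i j]
      by (cases i j rule: linorder_cases) blast+
  next
    case False
    then obtain v where "x = (\<lambda>_. v) \<or> y = (\<lambda>_. v)" using C_not_S[OF C(1)] C_not_S[OF C(2)] by blast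
    then show ?thesis
    proof
      assume x: "x = (\<lambda>_. v)"
      show ?thesis
        using single_move[OF C(2) B_C[OF b] C(1,3) r r r] D_swap_sides[of "y _" b v "c r"] x by simp
    next
      assume y: "y = (\<lambda>_. v)"
      show ?thesis
        using single_move[OF C(1,3,2) B_C[OF b] r r r] y by simp
    qed
  qed
qed

lemma tied_same_side_invariant:
  assumes C: "x \<in> C" "y \<in> C" "c \<in> C" and b: "b \<in> B"
    and ord: "p \<noteq> q" "p' \<noteq> q'" "p < q \<longleftrightarrow> p' < q'"
  shows "D (x p) (y p) (c q) b \<longleftrightarrow> D (x p') (y p') (c q') b"
proof -
  have tie: "D (x p) (y p) (c q) b \<longleftrightarrow> D (x p') (y p') (c q) b" if "apart q p p'" for p p' q
    by (rule tied_same_side[OF C b that])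
  have one: "D (x p) (y p) (c q) b \<longleftrightarrow> D (x p) (y p) (c q') b" if "apart p q q'" for p q q'
    using single_move[OF C(3) B_C[OF b] C(1,2) that that that] D_swap_sides by metis
  show ?thesis
  proof (cases "p < q")
    case True
    show ?thesis
      by (rule two_moves[where G = UNIV and R = "\<lambda>p q. D (x p) (y p) (c q) b"])
        (use True ord in \<open>auto intro!: tie one simp: apart_def\<close>)
  next
    case False
    show ?thesis
      by (rule two_moves[where G = UNIV and R = "\<lambda>q p. D (x p) (y p) (c q) b"])
        (use False ord in \<open>auto intro!: tie one simp: apart_def\<close>)
  qed
qed

lemma tied_between_invariant:
  assumes C: "x \<in> C" "y \<in> C" "c \<in> C" and b: "b \<in> B"
    and ord: "p \<noteq> q" "p' \<noteq> q'" "p < q \<longleftrightarrow> p' < q'"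
  shows "D (x p) (c q) (y p) b \<longleftrightarrow> D (x p') (c q') (y p') b"
proof -
  have tie: "D (x p) (c q) (y p) b \<longleftrightarrow> D (x p') (c q) (y p') b" if "apart q p p'" for p p' q
    by (rule tied_between[OF C b that])
  have one: "D (x p) (c q) (y p) b \<longleftrightarrow> D (x p) (c q') (y p) b" if "apart p q q'" for p q q'
    using single_move[OF C(3,1,2) B_C[OF b] that that that] D_swap_left by metis
  show ?thesis
  proof (cases "p < q")
    case True
    show ?thesis
      by (rule two_moves[where G = UNIV and R = "\<lambda>p q. D (x p) (c q) (y p) b"])
        (use True ord in \<open>auto intro!: tie one simp: apart_def\<close>)
  next
    case False
    show ?thesis
      by (rule two_moves[where G = UNIV and R = "\<lambda>q p. D (x p) (c q) (y p) b"])
        (use False ord in \<open>auto intro!: tie one simp: apart_def\<close>)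
  qed
qed

text \<open>Pulling v to a later k leaves only pairs tied. If xy|v_k b holds at i, it holds at j,
  and failure at j would give vy|v_k b at j, hence at i. Then b can be traded for v_k, leaving a
  relation among terms that moves to j, where v_k is traded back for b.\<close>

lemma tied_triple_S:
  assumes S: "x \<in> S" "y \<in> S" "v \<in> S" and b: "b \<in> B" and i: "D (x i) (y i) (v i) b"
  shows "D (x j) (y j) (v j) b"
proof (rule ccontr)
  assume j: "\<not> D (x j) (y j) (v j) b"
  note C = S[THEN S_C]
  obtain k where k: "i < k" "j < k" using ex_above[of "{i, j}"] by auto
  have same: "D (f i) (g i) (v k) b \<longleftrightarrow> D (f j) (g j) (v k) b" if "f \<in> C" "g \<in> C" for f g
    using tied_same_side_invariant[OF that C(3) b, of i k j k] k by auto
  have betw: "D (f i) (v k) (v i) b \<longleftrightarrow> D (f j) (v k) (v j) b" if "f \<in> C" for f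
    using tied_between_invariant[OF that C(3,3) b, of i k j k] k by auto
  show False
  proof (cases "D (x i) (y i) (v k) b")
    case True
    then have 1: "D (x j) (y j) (v k) b" using same C by blast
    have 2: "D (v j) (y j) (v k) b" using D_subst13[OF 1, of "v j"] j by blast
    then have 3: "D (v i) (y i) (v k) b" using same C by blast
    have 4: "D (x i) (y i) (v i) (v k)"
      using D_subst14[OF i, of "v k"] D_incompatible[OF 3] by blast
    have 5: "D (x j) (y j) (v j) (v k)"
      by (rule D_move[OF S S(3) 4]) (use k in \<open>auto simp: ord_eq_def\<close>)
    then show False
      using D_subst14[OF 5, of b] D_incompatible[OF 2] j by blast
  next
    case False
    \<comment> \<open>(D3) puts v_k in place of x as well as of y. Both results move to j, and
      transitivity through v_k restores the triple.\<close>
    have 1: "D (v k) (y i) (v i) b" "D (x i) (v k) (v i) b"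
      using D_subst13[OF i, of "v k"] D_subst23[OF i, of "v k"] False by blast+
    have "D (y j) (v k) (v j) b" "D (x j) (v k) (v j) b"
      using 1 betw[OF C(1)] betw[OF C(2)] D_swap_left by blast+
    then have "D (x j) (y j) (v j) b" using D_trans D_swap_left by blast
    then show False using j by blast
  qed
qed

lemma tied_triple:
  assumes C: "x \<in> C" "y \<in> C" "v \<in> C" and b: "b \<in> B"
  shows "D (x i) (y i) (v i) b \<longleftrightarrow> D (x j) (y j) (v j) b"
proof (cases "x \<in> S \<and> y \<in> S \<and> v \<in> S")
  case True
  then show ?thesis using tied_triple_S b by blast
next
  case False
  obtain k where "i < k" "j < k" using ex_above[of "{i, j}"] by auto
  then have k: "apart k i j" by (simp add: apart_def)
  from False obtain u where "x = (\<lambda>_. u) \<or> y = (\<lambda>_. u) \<or> v = (\<lambda>_. u)" using C[THEN C_not_S] by blast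
  then consider "x = (\<lambda>_. u)" | "y = (\<lambda>_. u)" | "v = (\<lambda>_. u)" by blast
  then show ?thesis
  proof cases
    case 1
    then show ?thesis using tied_between[OF C(2,3,1) b k] D_swap_left[of u] by simp
  next
    case 2
    then show ?thesis using tied_between[OF C(1,3,2) b k] by simp
  next
    case 3
    then show ?thesis using tied_same_side[OF C b k] by simp
  qed
qed

section \<open>All order types of the indices\<close>

lemma untied_invariant:
  assumes C: "x \<in> C" "y \<in> C" "v \<in> C" and b: "b \<in> B"
    and dist: "distinct [i, j, k]" and ord: "i < j \<longleftrightarrow> i' < j'" "j < i \<longleftrightarrow> j' < i'"
      "i < k \<longleftrightarrow> i' < k'" "k < i \<longleftrightarrow> k' < i'" "j < k \<longleftrightarrow> j' < k'" "k < j \<longleftrightarrow> k' < j'"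
  shows "D (x i) (y j) (v k) b \<longleftrightarrow> D (x i') (y j') (v k') b"
proof -
  \<comment> \<open>The constant sequence of b also needs an index; one already known to be apart is
    reused.\<close>
  have x: "D (x i) (y j) (v k) b \<longleftrightarrow> D (x i') (y j) (v k) b" if "apart j i i'" "apart k i i'" for i i' j k
    using single_move[OF C B_C[OF b] that that(1)] .
  have y: "D (x i) (y j) (v k) b \<longleftrightarrow> D (x i) (y j') (v k) b" if "apart i j j'" "apart k j j'" for i j j' k
    using single_move[OF C(2,1,3) B_C[OF b] that that(1)] D_swap_left by metis
  have v: "D (x i) (y j) (v k) b \<longleftrightarrow> D (x i) (y j) (v k') b" if "apart i k k'" "apart j k k'" for i j k k'
    using single_move[OF C(3) B_C[OF b] C(1,2) that(1) that] D_swap_sides by metis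
  let ?R = "\<lambda>i j k. D (x i) (y j) (v k) b"
  consider "i < j" "j < k" | "i < k" "k < j" | "j < i" "i < k" | "j < k" "k < i" | "k < i" "i < j" | "k < j" "j < i"
    using dist by fastforce
  then show ?thesis
  proof cases
    case 1
    show ?thesis by (rule three_moves[where R = "\<lambda>p q r. ?R p q r"]) (use 1 ord in \<open>auto intro!: x y v simp: apart_def\<close>)
  next
    case 2
    show ?thesis by (rule three_moves[where R = "\<lambda>p q r. ?R p r q"]) (use 2 ord in \<open>auto intro!: x y v simp: apart_def\<close>)
  next
    case 3
    show ?thesis by (rule three_moves[where R = "\<lambda>p q r. ?R q p r"]) (use 3 ord in \<open>auto intro!: x y v simp: apart_def\<close>)
  next
    case 4
    show ?thesis by (rule three_moves[where R = "\<lambda>p q r. ?R r p q"]) (use 4 ord in \<open>auto intro!: x y v simp: apart_def\<close>)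
  next
    case 5
    show ?thesis by (rule three_moves[where R = "\<lambda>p q r. ?R q r p"]) (use 5 ord in \<open>auto intro!: x y v simp: apart_def\<close>)
  next
    case 6
    show ?thesis by (rule three_moves[where R = "\<lambda>p q r. ?R r q p"]) (use 6 ord in \<open>auto intro!: x y v simp: apart_def\<close>)
  qed
qed

lemma invariant_with_parameter:
  assumes C: "x \<in> C" "y \<in> C" "v \<in> C" and b: "b \<in> B"
    and ord: "i < j \<longleftrightarrow> i' < j'" "j < i \<longleftrightarrow> j' < i'"
      "i < k \<longleftrightarrow> i' < k'" "k < i \<longleftrightarrow> k' < i'" "j < k \<longleftrightarrow> j' < k'" "k < j \<longleftrightarrow> k' < j'"
  shows "D (x i) (y j) (v k) b \<longleftrightarrow> D (x i') (y j') (v k') b"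
proof -
  have eq: "i = j \<longleftrightarrow> i' = j'" "i = k \<longleftrightarrow> i' = k'" "j = k \<longleftrightarrow> j' = k'"
    using ord by (metis linorder_neq_iff)+
  consider "i = j" "j = k" | "i = j" "j \<noteq> k" | "i = k" "j \<noteq> k" | "j = k" "i \<noteq> j" | "distinct [i, j, k]"
    by auto
  then show ?thesis
  proof cases
    case 1
    then show ?thesis using tied_triple[OF C b, of i i'] eq by auto
  next
    case 2
    then show ?thesis using tied_same_side_invariant[OF C b, of j k j' k'] eq ord by auto
  next
    case 3
    then show ?thesis using tied_between_invariant[OF C(1,3,2) b, of k j k' j'] eq ord by auto
  next
    case 4
    then show ?thesis using tied_between_invariant[OF C(2,3,1) b, of j i j' i'] eq ord D_swap_left by auto
  next
    case 5
    then show ?thesis using untied_invariant[OF C b 5 ord] by blast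
  qed
qed

lemma invariant:
  assumes C: "c1 \<in> C" "c2 \<in> C" "c3 \<in> C" "c4 \<in> C"
    and ord: "ord_eq [i1, i2, i3, i4] [j1, j2, j3, j4]"
  shows "D (c1 i1) (c2 i2) (c3 i3) (c4 i4) \<longleftrightarrow> D (c1 j1) (c2 j2) (c3 j3) (c4 j4)"
proof (cases "c1 \<in> S \<and> c2 \<in> S \<and> c3 \<in> S \<and> c4 \<in> S")
  case True
  then show ?thesis using D_order_invariant ord by blast
next
  case False
  have o: "i1 < i2 \<longleftrightarrow> j1 < j2" "i2 < i1 \<longleftrightarrow> j2 < j1" "i1 < i3 \<longleftrightarrow> j1 < j3" "i3 < i1 \<longleftrightarrow> j3 < j1"
    "i1 < i4 \<longleftrightarrow> j1 < j4" "i4 < i1 \<longleftrightarrow> j4 < j1" "i2 < i3 \<longleftrightarrow> j2 < j3" "i3 < i2 \<longleftrightarrow> j3 < j2"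
    "i2 < i4 \<longleftrightarrow> j2 < j4" "i4 < i2 \<longleftrightarrow> j4 < j2" "i3 < i4 \<longleftrightarrow> j3 < j4" "i4 < i3 \<longleftrightarrow> j4 < j3"
    using ord by (simp_all add: ord_eq_def)
  from False consider b where "b \<in> B" "c1 = (\<lambda>_. b)" | b where "b \<in> B" "c2 = (\<lambda>_. b)"
    | b where "b \<in> B" "c3 = (\<lambda>_. b)" | b where "b \<in> B" "c4 = (\<lambda>_. b)"
    using C[THEN C_not_S] by blast
  then show ?thesis
  proof cases
    case (1 b)
    then show ?thesis
      using invariant_with_parameter[OF C(3,4,2) 1(1), of i3 i4 j3 j4 i2 j2] o D_swap_sides D_swap_left by metis
  next
    case (2 b)
    then show ?thesis
      using invariant_with_parameter[OF C(3,4,1) 2(1), of i3 i4 j3 j4 i1 j1] o D_swap_sides by metis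
  next
    case (3 b)
    then show ?thesis
      using invariant_with_parameter[OF C(1,2,4) 3(1), of i1 i2 j1 j2 i4 j4] o D_swap_right by metis
  next
    case (4 b)
    then show ?thesis
      using invariant_with_parameter[OF C(1,2,3) 4(1), of i1 i2 j1 j2 i3 j3] o by simp
  qed
qed

end

section \<open>Parameters in the hull break invariance\<close>

context indiscernible_family
begin

text \<open>The hypotheses are the traces of weak indiscernibility on b and one component. In each
  branch, membership in the hull fixes a position of b among the terms, and shifting the indices
  contradicts it.\<close>

lemma avoids_hull_if_invariant:
  assumes t: "t \<in> S"
    and move: "\<And>i j k i' j' k'. ord_eq [i, j, k] [i', j', k'] \<Longrightarrow> D b (t i) (t j) (t k) \<Longrightarrow> D b (t i') (t j') (t k')"
    and eq: "\<And>i j. b = t i \<Longrightarrow> b = t j"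
  shows "b \<notin> hull1 D t"
proof
  assume b: "b \<in> hull1 D t"
  show False
  proof (cases rule: sequence_cases[OF t, case_names const petal line])
    case const
    then show False using b by (simp add: hull1_def)
  next
    case petal
    interpret petaled_seq D t using petal infinite_index by unfold_locales
    have "b \<in> petal_hull D t" using b petal by (simp add: hull1_def)
    then obtain i where i: "same_petal D t b (t i)"
      unfolding petal_hull_eq same_petal_def by blast
    obtain m where m: "\<And>k l. k \<noteq> m \<Longrightarrow> l \<noteq> m \<Longrightarrow> D b (t i) (t k) (t l)"
      using same_cofinal[OF i] by blast
    \<comment> \<open>With any other exceptional index, t_i could stand on both sides of one
      relation.\<close>
    have mi: "m = i"
    proof (rule ccontr)
      assume "m \<noteq> i"
      then have "D b (t i) (t i) (t i)" using m by simp
      then show False using D_disjoint by blast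
    qed
    obtain h where h: "h < i" using lt_ex by blast
    obtain j where j: "i < j" using gt_ex by blast
    obtain k where k: "j < k" using gt_ex by blast
    have 1: "D b (t i) (t j) (t k)" and 2: "D b (t i) (t h) (t k)" using m mi h j k by auto
    have "D b (t h) (t i) (t k)"
      by (rule move[OF _ 1]) (use h j k in \<open>auto simp: ord_eq_def\<close>)
    then show False using D_incompatible[OF 2] by blast
  next
    case line
    note mono = monotonic_D[OF line(3)]
    have inj: "t p = t q \<longleftrightarrow> p = q" for p q using line(3) by (auto simp: monotonic_def inj_def)
    have notin: "b \<noteq> t i" for i
    proof
      assume "b = t i"
      moreover obtain j where "i < j" using gt_ex by blast
      ultimately show False using eq[of i j] inj[of i j] by simp
    qed
    then have "b \<in> H1 D t \<union> H2 D t \<union> H3 D t" using b line by (auto simp: hull1_def)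
    then consider "b \<in> H1 D t" | "b \<in> H2 D t" | "b \<in> H3 D t" by blast
    then show False
    proof cases
      case 1
      then obtain i j k where ord: "i < j" "j < k" and D: "D (t i) (t k) (t j) b" unfolding H1_def by blast
      \<comment> \<open>With l beyond k, (D3) gives t_l t_k|t_j b, whereas shifting i, j, k to j, k,
        l in b t_j|t_i t_k gives b t_k|t_j t_l.\<close>
      obtain l where l: "k < l" using gt_ex by blast
      have "\<not> D (t i) (t k) (t j) (t l)" using D_incompatible[OF mono[OF ord l]] by blast
      then have lk: "D (t l) (t k) (t j) b" using D_subst14[OF D, of "t l"] by blast
      have 2: "D b (t j) (t i) (t k)" using D D_swap_sides D_swap_left by metis
      have "D b (t k) (t j) (t l)"
        by (rule move[OF _ 2]) (use ord l in \<open>auto simp: ord_eq_def\<close>)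
      then show False using D_incompatible[OF lk] by blast
    next
      case 2
      then obtain i j k where ord: "i < j" "j < k"
        and no: "\<And>p q r u. p \<in> {t i, t j, t k, b} \<Longrightarrow> q \<in> {t i, t j, t k, b} \<Longrightarrow> r \<in> {t i, t j, t k, b} \<Longrightarrow>
          u \<in> {t i, t j, t k, b} \<Longrightarrow> distinct [p, q, r, u] \<Longrightarrow> \<not> D p q r u"
        unfolding H2_def Let_def by blast
      have dist: "distinct [b, t i, t j, t k]" "distinct [b, t k, t i, t j]"
        using notin inj ord by auto
      have no1: "\<not> D b (t i) (t j) (t k)" by (rule no[OF _ _ _ _ dist(1)]) simp_all
      have no2: "\<not> D b (t k) (t i) (t j)" by (rule no[OF _ _ _ _ dist(2)]) simp_all
      obtain l where l: "k < l" using gt_ex by blast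
      \<comment> \<open>(D3) forces b into a relation with three increasing terms, either i, j, k
        themselves or a triple that shifts to them.\<close>
      from D_subst14[OF mono[OF ord l], of b] show False
      proof
        assume 1: "D b (t j) (t k) (t l)"
        have "D b (t i) (t j) (t k)" by (rule move[OF _ 1]) (use ord l in \<open>auto simp: ord_eq_def\<close>)
        then show False using no1 by blast
      next
        assume "D (t i) (t j) (t k) b"
        then show False using no2 D_swap_sides D_swap_left by metis
      qed
    next
      case 3
      then obtain i j k l where ord: "i < j" "j < k" "k < l"
        and D: "D (t i) b (t k) (t l)" "D (t i) (t j) b (t l)" unfolding H3_def by blast
      have 1: "D b (t i) (t k) (t l)" using D(1) D_swap_left by blast
      have "D b (t i) (t j) (t l)" by (rule move[OF _ 1]) (use ord in \<open>auto simp: ord_eq_def\<close>)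
      then show False using D_incompatible[OF D(2)] by blast
    qed
  qed
qed

end

section \<open>Translating \<open>weakly_indiscernible\<close>, and the theorem\<close>

lemma weakly_indiscernibleD:
  fixes t\<^sub>1 t\<^sub>2 t\<^sub>3 t\<^sub>4 :: "(nat, 'a) trm"
  assumes "weakly_indiscernible D n s B"
    and "params t\<^sub>1 \<union> params t\<^sub>2 \<union> params t\<^sub>3 \<union> params t\<^sub>4 \<subseteq> B"
    and "V = vars t\<^sub>1 \<union> vars t\<^sub>2 \<union> vars t\<^sub>3 \<union> vars t\<^sub>4"
    and "\<kappa> ` V \<subseteq> {1..n}" and "\<And>u v. u \<in> V \<Longrightarrow> v \<in> V \<Longrightarrow> \<iota> u < \<iota> v \<longleftrightarrow> \<iota>' u < \<iota>' v"
    and "e = (\<lambda>v. s (\<kappa> v) (\<iota> v))" and "e' = (\<lambda>v. s (\<kappa> v) (\<iota>' v))"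
    and "D (val e t\<^sub>1) (val e t\<^sub>2) (val e t\<^sub>3) (val e t\<^sub>4)"
  shows "D (val e' t\<^sub>1) (val e' t\<^sub>2) (val e' t\<^sub>3) (val e' t\<^sub>4)"
  using assms(1)[unfolded weakly_indiscernible_def Let_def, rule_format, of t\<^sub>1 t\<^sub>2 t\<^sub>3 t\<^sub>4 \<kappa> \<iota> \<iota>'] assms(2-8)
  by blast

lemma weakly_indiscernibleI:
  fixes s :: "nat \<Rightarrow> 'i::linorder \<Rightarrow> 'a"
  assumes inv: "\<And>c1 c2 c3 c4 i1 i2 i3 i4 j1 j2 j3 j4.
    \<lbrakk>{c1, c2, c3, c4} \<subseteq> s ` {1..n} \<union> (\<lambda>b _. b) ` B; ord_eq [i1, i2, i3, i4] [j1, j2, j3, j4]\<rbrakk> \<Longrightarrow>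
      D (c1 i1) (c2 i2) (c3 i3) (c4 i4) \<longleftrightarrow> D (c1 j1) (c2 j2) (c3 j3) (c4 j4)"
  shows "weakly_indiscernible D n s B"
  unfolding weakly_indiscernible_def Let_def
proof (intro allI impI, elim conjE)
  fix t1 t2 t3 t4 :: "(nat, 'a) trm" and \<kappa> and \<iota> \<iota>' :: "nat \<Rightarrow> 'i"
  define V where "V = vars t1 \<union> vars t2 \<union> vars t3 \<union> vars t4"
  assume par: "params t1 \<union> params t2 \<union> params t3 \<union> params t4 \<subseteq> B"
    and \<kappa>: "\<kappa> ` (vars t1 \<union> vars t2 \<union> vars t3 \<union> vars t4) \<subseteq> {1..n}"
    and ord: "\<forall>u\<in>vars t1 \<union> vars t2 \<union> vars t3 \<union> vars t4. \<forall>v\<in>vars t1 \<union> vars t2 \<union> vars t3 \<union> vars t4.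
      \<iota> u < \<iota> v \<longleftrightarrow> \<iota>' u < \<iota>' v"
  let ?e = "\<lambda>v. s (\<kappa> v) (\<iota> v)" and ?e' = "\<lambda>v. s (\<kappa> v) (\<iota>' v)"
  show "D (val ?e t1) (val ?e t2) (val ?e t3) (val ?e t4) \<longleftrightarrow>
    D (val ?e' t1) (val ?e' t2) (val ?e' t3) (val ?e' t4)"
  proof (cases "V = {}")
    case True
    have "val ?e t = val ?e' t" if "vars t = {}" for t :: "(nat, 'a) trm" using that by (cases t) auto
    then show ?thesis using True by (simp add: V_def)
  next
    case False
    then obtain v0 where v0: "v0 \<in> V" by blast
    define comp where "comp t = (case t of Var v \<Rightarrow> s (\<kappa> v) | Param b \<Rightarrow> (\<lambda>_. b))" for t :: "(nat, 'a) trm"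
    \<comment> \<open>A parameter borrows the index of the variable v0. Its constant sequence
      ignores it, while every index compared now belongs to \<open>V\<close>, where the order
      hypothesis applies.\<close>
    define var where "var t = (case t of Var v \<Rightarrow> v | Param b \<Rightarrow> v0)" for t :: "(nat, 'a) trm"
    have val: "val ?e t = comp t (\<iota> (var t))" "val ?e' t = comp t (\<iota>' (var t))" for t
      by (cases t; simp add: comp_def var_def)+
    have comp: "comp t \<in> s ` {1..n} \<union> (\<lambda>b _. b) ` B" if "vars t \<subseteq> V" "params t \<subseteq> B" for t
      using that \<kappa> unfolding V_def[symmetric] by (cases t) (auto simp: comp_def)
    have var: "var t \<in> V" if "vars t \<subseteq> V" for t :: "(nat, 'a) trm"
      using that v0 by (cases t) (auto simp: var_def)
    have sub: "vars t1 \<subseteq> V" "vars t2 \<subseteq> V" "vars t3 \<subseteq> V" "vars t4 \<subseteq> V" by (auto simp: V_def)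
    have "ord_eq [\<iota> (var t1), \<iota> (var t2), \<iota> (var t3), \<iota> (var t4)]
      [\<iota>' (var t1), \<iota>' (var t2), \<iota>' (var t3), \<iota>' (var t4)]"
      using ord sub[THEN var] unfolding V_def[symmetric] ord_eq_def by simp
    then show ?thesis unfolding val using comp sub par by (intro inv) auto
  qed
qed

theorem mainTheorem18:
  fixes D :: "'a \<Rightarrow> 'a \<Rightarrow> 'a \<Rightarrow> 'a \<Rightarrow> bool"
    and L :: "'p set"
    and U :: "'p \<Rightarrow> 'a \<Rightarrow> bool"
    and n :: nat
    and s :: "nat \<Rightarrow> 'i::{linorder, no_bot, no_top} \<Rightarrow> 'a"
    and B :: "'a set"
  assumes "D_set D"
    and "indiscernible D L U n s"
  shows "weakly_indiscernible D n s B \<longleftrightarrow> B \<inter> hull D n s = {}"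
proof -
  interpret D_set D by fact
  interpret indiscernible_family D "s ` {1..n}"
    by unfold_locales (use indiscernible_D[OF assms(2)] in blast)
  show ?thesis
  proof
    assume W: "weakly_indiscernible D n s B"
    have "b \<notin> hull1 D (s k)" if b: "b \<in> B" and k: "k \<in> {1..n}" for b k
    proof (rule avoids_hull_if_invariant)
      show "s k \<in> s ` {1..n}" using k by blast
    next
      fix i j l i' j' l' assume o: "ord_eq [i, j, l] [i', j', l']" and D: "D b (s k i) (s k j) (s k l)"
      define f where "f p q r v = (if v = 0 then p else if v = 1 then q else r)" for p q r :: 'i and v :: nat
      have f: "f p q r 0 = p" "f p q r 1 = q" "f p q r 2 = r" for p q r by (simp_all add: f_def)
      have "D (val (\<lambda>v. s k (f i' j' l' v)) (Param b)) (val (\<lambda>v. s k (f i' j' l' v)) (Var 0))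
        (val (\<lambda>v. s k (f i' j' l' v)) (Var 1)) (val (\<lambda>v. s k (f i' j' l' v)) (Var 2))"
        by (rule weakly_indiscernibleD[OF W _ refl, where \<kappa> = "\<lambda>_. k" and \<iota> = "f i j l" and \<iota>' = "f i' j' l'"])
          (use b k o D in \<open>auto simp: f ord_eq_def f_def\<close>)
      then show "D b (s k i') (s k j') (s k l')" by (simp add: f_def)
    next
      fix i j assume b_eq: "b = s k i"
      show "b = s k j"
      proof (rule ccontr)
        assume "b \<noteq> s k j"
        \<comment> \<open>Inequality is expressed by \<open>D\<close>, so b differing from the term
          at j would transfer to the term at i, which equals b.\<close>
        then have D: "D (s k j) (s k j) b b" by (simp add: D_refl)
        have "D (val (\<lambda>_. s k i) (Var (0::nat))) (val (\<lambda>_. s k i) (Var (0::nat)))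
          (val (\<lambda>_::nat. s k i) (Param b)) (val (\<lambda>_::nat. s k i) (Param b))"
          by (rule weakly_indiscernibleD[OF W _ refl, where \<kappa> = "\<lambda>_. k" and \<iota> = "\<lambda>_. j" and \<iota>' = "\<lambda>_. i"])
            (use b k D in auto)
        then show False using b_eq by (simp add: D_refl)
      qed
    qed
    then show "B \<inter> hull D n s = {}" unfolding hull_def by blast
  next
    assume "B \<inter> hull D n s = {}"
    then interpret avoiding_family D "s ` {1..n}" B
      by unfold_locales (auto simp: hull_def)
    show "weakly_indiscernible D n s B"
      by (rule weakly_indiscernibleI, rule invariant) (unfold C_def, blast+)
  qed
qed

end
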